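(* Let $\Omega\subset\mathbb R^n$ be an open and bounded domain with piecewise smooth boundary $\partial\Omega$. Every solution $u^*$ of $$u^*\in\arg\min_{u\in W^{1,\infty}_0(\Omega)\setminus\{0\}}\frac{\|\nabla u\|_\infty}{\|u\|_2}$$ is a scalar multiple of the distance function $d_\Omega(x):=\mathrm{dist}(x,\partial\Omega)=\inf_{y\in\partial\Omega}|x-y|$, $x\in\Omega$.
   Context: $W^{1,\infty}_0(\Omega):=\{u\in W^{1,\infty}(\Omega): u=0\text{ on }\partial\Omega\}$; $\|\nabla u\|_\infty$ is the essential supremum over $\Omega$ of the Euclidean norm $|\nabla u|$, and $\|u\|_2$ is the $L^2(\Omega)$ norm. *)

theory Defs
  imports "HOL-Analysis.Analysis" "HOL-Probability.Essential_Supremum"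
begin

section \<open>Smooth functions\<close>

primrec Ck_on :: "nat \<Rightarrow> 'a::euclidean_space set \<Rightarrow> ('a \<Rightarrow> real) \<Rightarrow> bool" where
  "Ck_on 0 S f \<longleftrightarrow> continuous_on S f"
| "Ck_on (Suc k) S f \<longleftrightarrow>
     (\<forall>x\<in>S. f differentiable (at x)) \<and>
     (\<forall>b\<in>Basis. Ck_on k S (\<lambda>x. frechet_derivative f (at x) b))"

text \<open>Only meaningful for open \<open>S\<close>.\<close>

definition smooth_on :: "'a::euclidean_space set \<Rightarrow> ('a \<Rightarrow> real) \<Rightarrow> bool" where
  "smooth_on S f \<longleftrightarrow> (\<forall>k. Ck_on k S f)"

definition test_functions :: "'a::euclidean_space set \<Rightarrow> ('a \<Rightarrow> real) set" where
  "test_functions \<Omega> =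
     {\<phi>. smooth_on UNIV \<phi> \<and> compact (closure {x. \<phi> x \<noteq> 0}) \<and> closure {x. \<phi> x \<noteq> 0} \<subseteq> \<Omega>}"


section \<open>Piecewise smooth boundary\<close>

text \<open>Hypersurfaces are embedded, of codimension one and without boundary; they are given locally
  as regular level sets. In dimension one they are the discrete sets.\<close>

definition smooth_hypersurface :: "'a::euclidean_space set \<Rightarrow> bool" where
  "smooth_hypersurface S \<longleftrightarrow>
     (\<forall>p\<in>S. \<exists>U F. open U \<and> p \<in> U \<and> smooth_on U F \<and>
        S \<inter> U = {x \<in> U. F x = 0} \<and>
        (\<forall>x\<in>U. frechet_derivative F (at x) \<noteq> (\<lambda>_. 0)))"

text \<open>For compact \<open>S\<close> this says that the \<open>k\<close>-dimensional Hausdorff measure of \<open>S\<close> vanishes: by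
  compactness finite covers by open balls suffice, and for \<open>k > 0\<close> a small sum forces small radii.
  For \<open>k = 0\<close> it says that \<open>S\<close> is empty.\<close>

definition hausdorff_null :: "nat \<Rightarrow> 'a::metric_space set \<Rightarrow> bool" where
  "hausdorff_null k S \<longleftrightarrow>
     (\<forall>e>0. \<exists>C :: ('a \<times> real) set. finite C \<and> (\<forall>(c, r)\<in>C. 0 < r) \<and>
        S \<subseteq> (\<Union>(c, r)\<in>C. ball c r) \<and> (\<Sum>(c, r)\<in>C. r ^ k) < e)"

text \<open>The boundary is the union of the closures of finitely many connected, relatively open smooth
  pieces, and the part of it not covered by the pieces themselves (edges, corners, vertices) has
  zero surface measure. Neither a Lipschitz condition nor a position of \<open>\<Omega>\<close> on one side of its
  boundary is imposed, so cusps and slits are allowed. The exceptional set is closed in the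
  boundary, hence compact for bounded \<open>\<Omega>\<close>.\<close>

definition piecewise_smooth_boundary :: "'a::euclidean_space set \<Rightarrow> bool" where
  "piecewise_smooth_boundary \<Omega> \<longleftrightarrow>
     (\<exists>\<G>. finite \<G> \<and>
        (\<forall>\<Gamma>\<in>\<G>. smooth_hypersurface \<Gamma> \<and> connected \<Gamma> \<and>
                 openin (top_of_set (frontier \<Omega>)) \<Gamma>) \<and>
        frontier \<Omega> = (\<Union>\<Gamma>\<in>\<G>. closure \<Gamma>) \<and>
        hausdorff_null (DIM('a) - 1) (frontier \<Omega> - \<Union>\<G>))"


section \<open>Lebesgue and Sobolev spaces\<close>

text \<open>Elements of the function spaces are represented by functions on the whole space, of which
  only the restriction to \<open>\<Omega>\<close> up to null sets is relevant.\<close>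

definition L2_norm :: "'a::euclidean_space set \<Rightarrow> ('a \<Rightarrow> real) \<Rightarrow> real" where
  "L2_norm \<Omega> u = sqrt (\<integral>x. (u x)\<^sup>2 \<partial>lebesgue_on \<Omega>)"

definition Linf :: "'a::euclidean_space set \<Rightarrow> ('a \<Rightarrow> 'b::euclidean_space) set" where
  "Linf \<Omega> = {f. f \<in> borel_measurable (lebesgue_on \<Omega>) \<and>
                esssup (lebesgue_on \<Omega>) (\<lambda>x. ereal (norm (f x))) < \<infinity>}"

definition Linf_norm :: "'a::euclidean_space set \<Rightarrow> ('a \<Rightarrow> 'b::euclidean_space) \<Rightarrow> real" where
  "Linf_norm \<Omega> f = real_of_ereal (esssup (lebesgue_on \<Omega>) (\<lambda>x. ereal (norm (f x))))"

definition locally_integrable ::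
  "'a::euclidean_space set \<Rightarrow> ('a \<Rightarrow> 'b::euclidean_space) \<Rightarrow> bool" where
  "locally_integrable \<Omega> f \<longleftrightarrow> (\<forall>K. compact K \<and> K \<subseteq> \<Omega> \<longrightarrow> f absolutely_integrable_on K)"

definition has_weak_gradient ::
  "'a::euclidean_space set \<Rightarrow> ('a \<Rightarrow> real) \<Rightarrow> ('a \<Rightarrow> 'a) \<Rightarrow> bool" where
  "has_weak_gradient \<Omega> u g \<longleftrightarrow>
     locally_integrable \<Omega> u \<and> locally_integrable \<Omega> g \<and>
     (\<forall>\<phi>\<in>test_functions \<Omega>. \<forall>b\<in>Basis.
        (\<integral>x. u x * frechet_derivative \<phi> (at x) b \<partial>lebesgue_on \<Omega>) =
        - (\<integral>x. (g x \<bullet> b) * \<phi> x \<partial>lebesgue_on \<Omega>))"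

text \<open>The weak gradient is unique up to null sets, so the choice does not affect norms.\<close>

definition weak_gradient :: "'a::euclidean_space set \<Rightarrow> ('a \<Rightarrow> real) \<Rightarrow> 'a \<Rightarrow> 'a" where
  "weak_gradient \<Omega> u = (SOME g. has_weak_gradient \<Omega> u g)"

definition W1inf :: "'a::euclidean_space set \<Rightarrow> ('a \<Rightarrow> real) set" where
  "W1inf \<Omega> = {u \<in> Linf \<Omega>. \<exists>g\<in>Linf \<Omega>. has_weak_gradient \<Omega> u g}"

text \<open>Boundary values are those of a representative that is continuous up to the boundary.\<close>

definition W1inf0 :: "'a::euclidean_space set \<Rightarrow> ('a \<Rightarrow> real) set" where
  "W1inf0 \<Omega> = {u \<in> W1inf \<Omega>. \<exists>v. continuous_on (closure \<Omega>) v \<and>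
                 (AE x in lebesgue_on \<Omega>. v x = u x) \<and> (\<forall>x\<in>frontier \<Omega>. v x = 0)}"

definition W1inf0_nonzero :: "'a::euclidean_space set \<Rightarrow> ('a \<Rightarrow> real) set" where
  "W1inf0_nonzero \<Omega> = {u \<in> W1inf0 \<Omega>. \<not> (AE x in lebesgue_on \<Omega>. u x = 0)}"

definition rayleigh_quotient :: "'a::euclidean_space set \<Rightarrow> ('a \<Rightarrow> real) \<Rightarrow> real" where
  "rayleigh_quotient \<Omega> u = Linf_norm \<Omega> (weak_gradient \<Omega> u) / L2_norm \<Omega> u"

end

theory Submission
  imports Defs
begin

text \<open>
  Let \<open>v\<close> be the representative of the minimiser \<open>u\<close> that is continuous up to the boundary, \<open>L\<close> the
  essential supremum of the norm of its weak gradient and \<open>d\<close> the distance to the boundary.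
  Inside \<open>\<Omega>\<close> the function \<open>v\<close> is \<open>L\<close>-Lipschitz along segments
  (\<open>essentially_lipschitz_on_segment\<close>). The segment from a point to a nearest boundary point runs inside
  \<open>\<Omega>\<close> up to its endpoint, where \<open>v\<close> vanishes, so \<open>\<bar>v\<bar> \<le> L * d\<close> on \<open>\<Omega>\<close>
  (\<open>le_gradient_bound_times_infdist\<close>). The distance \<open>d\<close> is itself admissible and its gradient has norm at
  most 1 (\<open>infdist_frontier_admissible\<close>), so minimality of \<open>u\<close> gives the reverse inequality
  \<open>L * L2_norm \<Omega> d \<le> L2_norm \<Omega> u\<close>. Hence the pointwise inequality is an equality almost everywhere, and
  by continuity \<open>\<bar>v\<bar> = L * d\<close> on all of \<open>\<Omega>\<close>. As \<open>d\<close> is positive on the connected set \<open>\<Omega>\<close>, the sign of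
  \<open>v\<close> is constant (if \<open>L = 0\<close> then \<open>v = 0\<close>), and \<open>v\<close> is \<open>L * d\<close> or \<open>- L * d\<close>.

  Two analytic facts carry this argument. The first, the Lipschitz bound, comes from mollification with
  explicit smooth bumps. The same bumps yield the fundamental lemma of the calculus of variations and with it
  the uniqueness of weak gradients (\<open>weak_gradient_unique\<close>), by which the gradient chosen in the
  definition of the quotient may be replaced by any concrete one.

  The second is that \<open>d\<close> has a weak gradient of norm at most 1. Rademacher's theorem would give it, but for distance
  functions a direct argument suffices. The nearest point map of a compact set is monotone, and
  translation invariance of the integral turns monotonicity into uniqueness of the nearest point
  almost everywhere (\<open>AE_nearest_height_unique\<close>). Where the nearest point \<open>y\<close> of \<open>x\<close> is unique, the candidate
  gradient is the unit vector pointing from \<open>y\<close> to \<open>x\<close>. Comparing distances to the nearest points of \<open>x\<close> and of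
  \<open>x + t *\<^sub>R b\<close> encloses the difference quotient of \<open>d\<close> between the components of the candidate at these
  two points, and testing against a smooth function lets \<open>t\<close> tend to \<open>0\<close>
  (\<open>infdist_partial_integration\<close>).
\<close>


section \<open>Smooth bump functions on boxes\<close>

lemma frechet_derivative_eqI:
  "(f has_derivative f') (at x) \<Longrightarrow> frechet_derivative f (at x) = f'"
  by (metis frechet_derivative_at)

lemma Ck_on_SucI:
  assumes "\<And>x. (f has_derivative f' x) (at x)"
    and "\<And>b. b \<in> Basis \<Longrightarrow> Ck_on k UNIV (\<lambda>x. f' x b)"
  shows "Ck_on (Suc k) UNIV f"
  using assms by (auto simp: frechet_derivative_eqI[OF assms(1)] differentiable_def)

lemma Ck_on_SucD:
  assumes "Ck_on (Suc k) UNIV f"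
  shows "(f has_derivative frechet_derivative f (at x)) (at x)"
    and "b \<in> Basis \<Longrightarrow> Ck_on k UNIV (\<lambda>x. frechet_derivative f (at x) b)"
  using assms by (auto simp: frechet_derivative_works)

lemma Ck_on_decrease: "Ck_on (Suc k) UNIV f \<Longrightarrow> Ck_on k UNIV f"
proof (induction k arbitrary: f)
  case 0
  then show ?case
    by (auto intro!: differentiable_imp_continuous_on simp: differentiable_on_def)
next
  case (Suc k)
  then show ?case
    by (metis Ck_on.simps(2))
qed

lemma Ck_on_const: "Ck_on k UNIV (\<lambda>_. c)"
proof (induction k arbitrary: c)
  case (Suc k)
  show ?case by (rule Ck_on_SucI[where f' = "\<lambda>_ _. 0"]) (auto intro: Suc)
qed simp

lemma Ck_on_inner: "Ck_on k UNIV (\<lambda>x. x \<bullet> c)"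
proof (cases k)
  case (Suc j)
  show ?thesis unfolding Suc
    by (rule Ck_on_SucI[where f' = "\<lambda>_ h. h \<bullet> c"])
       (auto intro!: derivative_eq_intros Ck_on_const)
qed (auto intro!: continuous_intros)

lemma Ck_on_add: "Ck_on k UNIV f \<Longrightarrow> Ck_on k UNIV g \<Longrightarrow> Ck_on k UNIV (\<lambda>x. f x + g x)"
proof (induction k arbitrary: f g)
  case (Suc k)
  note f = Ck_on_SucD[OF Suc.prems(1)] and g = Ck_on_SucD[OF Suc.prems(2)]
  show ?case
    by (rule Ck_on_SucI[OF has_derivative_add[OF f(1) g(1)]]) (intro Suc.IH f(2) g(2))
qed (auto intro!: continuous_intros)

lemma Ck_on_mult: "Ck_on k UNIV f \<Longrightarrow> Ck_on k UNIV g \<Longrightarrow> Ck_on k UNIV (\<lambda>x. f x * g x)"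
proof (induction k arbitrary: f g)
  case (Suc k)
  note f = Ck_on_SucD[OF Suc.prems(1)] and g = Ck_on_SucD[OF Suc.prems(2)]
  show ?case
    by (rule Ck_on_SucI[OF has_derivative_mult[OF f(1) g(1)]])
       (intro Ck_on_add Suc.IH f(2) g(2) Suc.prems[THEN Ck_on_decrease])
qed (auto intro!: continuous_intros)

lemma Ck_on_prod:
  "finite I \<Longrightarrow> (\<And>i. i \<in> I \<Longrightarrow> Ck_on k UNIV (f i)) \<Longrightarrow> Ck_on k UNIV (\<lambda>x. \<Prod>i\<in>I. f i x)"
  by (induction I rule: finite_induct) (auto intro: Ck_on_const Ck_on_mult)

text \<open>The powers of \<open>t\<close> in the denominator make this family closed, up to linear
  combinations, under differentiation; \<open>flat_exp 0\<close> is the usual smooth function that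
  vanishes exactly on the nonpositive half-line.\<close>

definition flat_exp :: "nat \<Rightarrow> real \<Rightarrow> real" where
  "flat_exp j t = (if t \<le> 0 then 0 else exp (- 1 / t) / t ^ j)"

text \<open>A single term of the exponential series already beats the denominator. The quadratic
  rate is what makes the difference quotients at the origin tend to \<open>0\<close>.\<close>

lemma flat_exp_le:
  assumes "0 < t" shows "flat_exp j t \<le> fact (j + 2) * t\<^sup>2"
proof -
  have "(1/t) ^ (j + 2) / fact (j + 2) \<le> exp (1 / t)"
  proof -
    have "(\<Sum>n\<in>{j+2}. (1/t) ^ n /\<^sub>R fact n) \<le> (\<Sum>n. (1/t) ^ n /\<^sub>R fact n)"
      using assms by (intro sum_le_suminf summable_exp_generic) auto
    then show ?thesis by (simp add: exp_def divide_inverse mult.commute)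
  qed
  then have "exp (- 1 / t) \<le> fact (j + 2) * t ^ (j + 2)"
    using assms by (simp add: exp_minus divide_simps power_one_over mult_ac del: fact_Suc)
  then show ?thesis
    using assms by (simp add: flat_exp_def divide_simps power_add mult_ac power2_eq_square)
qed

lemma flat_exp_deriv:
  "(flat_exp j has_real_derivative flat_exp (j + 2) t - real j * flat_exp (j + 1) t) (at t)"
proof -
  consider "t < 0" | "t = 0" | "t > 0" by linarith
  then show ?thesis
  proof cases
    case 1
    have "(flat_exp j has_real_derivative 0) (at t)"
    proof (rule has_field_derivative_transform_within_open[where f = "\<lambda>_. 0" and S = "{..<0}"])
    qed (use 1 in \<open>auto simp: flat_exp_def\<close>)
    with 1 show ?thesis by (simp add: flat_exp_def)
  next
    case 2
    have "((\<lambda>h. flat_exp j h / h) \<longlongrightarrow> 0) (at 0)"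
    proof (rule Lim_null_comparison[where g = "\<lambda>h. fact (j + 2) * \<bar>h\<bar>"])
      have "norm (flat_exp j h / h) \<le> fact (j + 2) * \<bar>h\<bar>" for h
      proof (cases "h > 0")
        case True
        then have "flat_exp j h \<le> (fact (j + 2) * h) * h"
          using flat_exp_le[of h j] by (simp add: power2_eq_square mult_ac)
        moreover have "0 \<le> flat_exp j h" using True by (simp add: flat_exp_def)
        ultimately show ?thesis
          using True by (simp add: pos_divide_le_eq del: fact_Suc)
      next
        case False
        have "0 \<le> fact (j + 2) * \<bar>h\<bar>" by (intro mult_nonneg_nonneg) simp_all
        with False show ?thesis by (simp add: flat_exp_def del: fact_Suc)
      qed
      then show "\<forall>\<^sub>F h in at 0. norm (flat_exp j h / h) \<le> fact (j + 2) * \<bar>h\<bar>" by simp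
      show "((\<lambda>h::real. fact (j + 2) * \<bar>h\<bar>) \<longlongrightarrow> 0) (at 0)"
        by (rule tendsto_eq_intros refl)+ simp
    qed
    then show ?thesis using 2 by (simp add: flat_exp_def DERIV_def)
  next
    case 3
    have "((\<lambda>t. exp (- 1 / t) / t ^ j) has_real_derivative
        flat_exp (j + 2) t - real j * flat_exp (j + 1) t) (at t)"
      using 3
      apply (auto intro!: derivative_eq_intros simp: flat_exp_def)
      apply (cases j)
      apply (auto simp: field_simps power2_eq_square)
      done
    then show ?thesis
      by (rule has_field_derivative_transform_within_open[where S = "{0<..}"])
        (use 3 in \<open>auto simp: flat_exp_def\<close>)
  qed
qed

text \<open>One derivative leads from \<open>flat_exp j\<close> to \<open>flat_exp (j + 1)\<close> and
  \<open>flat_exp (j + 2)\<close>, so the induction on the order of differentiability has to treat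
  all \<open>j\<close> at once.\<close>

lemma Ck_on_flat_exp:
  assumes "\<And>k. Ck_on k UNIV s" shows "Ck_on k UNIV (\<lambda>x. flat_exp j (s x))"
proof (induction k arbitrary: j)
  case 0
  have "continuous_on UNIV (flat_exp j)"
    by (meson DERIV_continuous continuous_at_imp_continuous_on flat_exp_deriv)
  moreover have "continuous_on UNIV s" using assms[of 0] by simp
  ultimately show ?case
    by (auto intro: continuous_on_compose2)
next
  case (Suc k)
  have s: "(s has_derivative frechet_derivative s (at x)) (at x)" for x
    using Ck_on_SucD(1)[OF assms] .
  show ?case
  proof (rule Ck_on_SucI)
    show "((\<lambda>x. flat_exp j (s x)) has_derivative
       (\<lambda>h. (flat_exp (j + 2) (s x) + (- real j) * flat_exp (j + 1) (s x)) *
            frechet_derivative s (at x) h)) (at x)" for x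
      using has_derivative_compose[OF s flat_exp_deriv[unfolded has_field_derivative_def]]
      by simp
    show "Ck_on k UNIV (\<lambda>x. (flat_exp (j + 2) (s x) + (- real j) * flat_exp (j + 1) (s x)) *
            frechet_derivative s (at x) b)" if "b \<in> Basis" for b
      by (intro Ck_on_mult Ck_on_add Ck_on_const Suc.IH Ck_on_SucD(2)[OF assms] that)
  qed
qed

text \<open>For \<open>m > 0\<close> and a nonempty box, this is positive exactly on \<open>box a b\<close>. The factor \<open>m\<close> steepens the walls: for
  \<open>m \<longlonglongrightarrow> \<infinity>\<close> the bump increases to the indicator function of the box, while for
  fixed \<open>m\<close> translating the box translates the bump.\<close>

definition box_bump :: "real \<Rightarrow> 'a::euclidean_space \<Rightarrow> 'a \<Rightarrow> 'a \<Rightarrow> real" where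
  "box_bump m a b x = (\<Prod>i\<in>Basis. flat_exp 0 (m * ((x \<bullet> i - a \<bullet> i) * (b \<bullet> i - x \<bullet> i))))"

lemma flat_exp_0_range: "0 \<le> flat_exp 0 t" "flat_exp 0 t \<le> 1" "flat_exp 0 t = 0 \<longleftrightarrow> t \<le> 0"
  by (auto simp: flat_exp_def)

lemma mult_interval_pos_iff:
  fixes a b c :: real assumes "a \<le> b"
  shows "0 < (c - a) * (b - c) \<longleftrightarrow> a < c \<and> c < b"
  using assms by (auto simp: zero_less_mult_iff)

lemma box_bump_range: "0 \<le> box_bump m a b x" "box_bump m a b x \<le> 1"
  unfolding box_bump_def by (auto intro!: prod_nonneg prod_le_1 flat_exp_0_range)

lemma box_bump_pos:
  assumes "0 < m" "x \<in> box a b" shows "0 < box_bump m a b x"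
  using assms unfolding box_bump_def
  by (intro prod_pos) (auto simp: flat_exp_def mem_box mult_pos_pos not_le[symmetric] mult_le_0_iff)

lemma box_bump_outside:
  assumes "0 < m" "box a b \<noteq> {}" "x \<notin> box a b" shows "box_bump m a b x = 0"
proof -
  have ab: "a \<bullet> i < b \<bullet> i" if "i \<in> Basis" for i using assms(2) that by (auto simp: box_ne_empty)
  obtain i where i: "i \<in> Basis" "\<not> (a \<bullet> i < x \<bullet> i \<and> x \<bullet> i < b \<bullet> i)" using assms(3) by (auto simp: mem_box)
  then have "\<not> 0 < (x \<bullet> i - a \<bullet> i) * (b \<bullet> i - x \<bullet> i)"
    using ab[OF i(1)] by (subst mult_interval_pos_iff) auto
  then have "flat_exp 0 (m * ((x \<bullet> i - a \<bullet> i) * (b \<bullet> i - x \<bullet> i))) = 0"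
    using assms(1) by (simp add: flat_exp_0_range(3) mult_nonneg_nonpos not_less)
  then show ?thesis
    using i(1) unfolding box_bump_def by (intro prod_zero) auto
qed

lemma box_bump_test_function:
  assumes "0 < m" "box a b \<noteq> {}" "cbox a b \<subseteq> \<Omega>"
  shows "box_bump m a b \<in> test_functions \<Omega>"
proof -
  have "Ck_on k UNIV (\<lambda>x::'a. m * ((x \<bullet> i + (- (a \<bullet> i))) * (b \<bullet> i + (-1) * (x \<bullet> i))))" for k i
    by (intro Ck_on_mult Ck_on_add Ck_on_const Ck_on_inner)
  then have "Ck_on k UNIV (box_bump m a b)" for k
    unfolding box_bump_def
    by (intro Ck_on_prod Ck_on_flat_exp) (simp_all add: algebra_simps)
  moreover have "{x. box_bump m a b x \<noteq> 0} \<subseteq> cbox a b"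
    using box_bump_outside[OF assms(1,2)] box_subset_cbox by blast
  then have "closure {x. box_bump m a b x \<noteq> 0} \<subseteq> cbox a b"
    by (intro closure_minimal) auto
  moreover from this have "compact (closure {x. box_bump m a b x \<noteq> 0})"
    by (metis bounded_cbox bounded_subset closed_closure compact_eq_bounded_closed)
  ultimately show ?thesis
    using assms(3) by (auto simp: test_functions_def smooth_on_def)
qed

lemma box_bump_tendsto_indicator:
  assumes "box a b \<noteq> {}"
  shows "(\<lambda>k. box_bump (real (Suc k)) a b x) \<longlonglongrightarrow> indicator (box a b) x"
proof (cases "x \<in> box a b")
  case True
  have "(\<lambda>k. flat_exp 0 (real (Suc k) * c)) \<longlonglongrightarrow> 1" if "0 < c" for c
  proof -
    have "(\<lambda>k. exp (- 1 / (real (Suc k) * c))) = (\<lambda>k. exp ((- 1 / c) * inverse (real (Suc k))))"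
      by (auto simp: field_simps)
    moreover have "(\<lambda>k. exp ((- 1 / c) * inverse (real (Suc k)))) \<longlonglongrightarrow> exp ((- 1/c) * 0)"
      by (intro tendsto_intros LIMSEQ_inverse_real_of_nat)
    ultimately show ?thesis using that by (simp add: flat_exp_def mult_le_0_iff)
  qed
  then have "(\<lambda>k. box_bump (real (Suc k)) a b x) \<longlonglongrightarrow> (\<Prod>i\<in>(Basis::'a set). 1)"
    unfolding box_bump_def using True by (intro tendsto_prod) (auto simp: mem_box)
  then show ?thesis using True by simp
next
  case False
  then show ?thesis using box_bump_outside[OF _ assms] by simp
qed


section \<open>Test functions and uniqueness of weak gradients\<close>

lemma test_function_smooth:
  assumes "\<phi> \<in> test_functions \<Omega>"
  shows "Ck_on k UNIV \<phi>"
  using assms by (auto simp: test_functions_def smooth_on_def)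

lemma test_function_has_derivative:
  assumes "\<phi> \<in> test_functions \<Omega>"
  shows "(\<phi> has_derivative frechet_derivative \<phi> (at x)) (at x)"
  using Ck_on_SucD(1)[OF test_function_smooth[OF assms]] .

lemma test_function_continuous:
  assumes "\<phi> \<in> test_functions \<Omega>" shows "continuous_on S \<phi>"
  using test_function_smooth[OF assms, of 0] by (auto intro: continuous_on_subset)

lemma test_function_zero:
  assumes "\<phi> \<in> test_functions \<Omega>" "x \<notin> \<Omega>" shows "\<phi> x = 0"
proof -
  have "{x. \<phi> x \<noteq> 0} \<subseteq> \<Omega>"
    using assms(1) closure_subset[of "{x. \<phi> x \<noteq> 0}"] by (auto simp: test_functions_def)
  then show ?thesis using assms(2) by auto
qed

text \<open>This makes every integrability statement about test functions available for their
  partial derivatives as well.\<close>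

lemma test_function_partial:
  assumes \<phi>: "\<phi> \<in> test_functions \<Omega>" and b: "b \<in> Basis"
  shows "(\<lambda>x. frechet_derivative \<phi> (at x) b) \<in> test_functions \<Omega>"
proof -
  let ?K = "closure {x. \<phi> x \<noteq> 0}"
  have "frechet_derivative \<phi> (at x) b = 0" if "x \<notin> ?K" for x
  proof -
    have "(\<phi> has_derivative (\<lambda>_. 0)) (at x)"
    proof (rule has_derivative_transform_within_open[where f = "\<lambda>_. 0" and s = "- ?K"])
      show "0 = \<phi> y" if "y \<in> - ?K" for y
        using that closure_subset[of "{x. \<phi> x \<noteq> 0}"] by auto
    qed (use \<open>x \<notin> ?K\<close> in auto)
    then show ?thesis by (simp add: frechet_derivative_eqI)
  qed
  then have "{x. frechet_derivative \<phi> (at x) b \<noteq> 0} \<subseteq> ?K" by blast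
  then have sub: "closure {x. frechet_derivative \<phi> (at x) b \<noteq> 0} \<subseteq> ?K"
    by (intro closure_minimal) auto
  moreover have "compact (closure {x. frechet_derivative \<phi> (at x) b \<noteq> 0})"
    using \<phi> sub by (auto simp: test_functions_def compact_eq_bounded_closed intro: bounded_subset)
  ultimately show ?thesis
    using \<phi> Ck_on_SucD(2)[OF test_function_smooth[OF \<phi>] b]
    unfolding test_functions_def smooth_on_def by blast
qed

lemma test_function_support:
  assumes "\<phi> \<in> test_functions \<Omega>"
  obtains K where "compact K" "K \<subseteq> \<Omega>" "\<And>x. x \<notin> K \<Longrightarrow> \<phi> x = 0"
proof (rule that[of "closure {x. \<phi> x \<noteq> 0}"])
  show "\<phi> x = 0" if "x \<notin> closure {x. \<phi> x \<noteq> 0}" for x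
    using that closure_subset[of "{x. \<phi> x \<noteq> 0}"] by blast
qed (use assms in \<open>simp_all add: test_functions_def\<close>)

lemma test_function_bounded:
  assumes "\<phi> \<in> test_functions \<Omega>"
  obtains C where "\<And>x. \<bar>\<phi> x\<bar> \<le> C"
proof -
  obtain K where K: "compact K" "\<And>x. x \<notin> K \<Longrightarrow> \<phi> x = 0"
    using test_function_support[OF assms] by metis
  then have "bounded (\<phi> ` K)"
    using compact_continuous_image compact_imp_bounded test_function_continuous[OF assms] by blast
  then obtain C where C: "\<And>x. x \<in> K \<Longrightarrow> \<bar>\<phi> x\<bar> \<le> C" by (auto simp: bounded_iff)
  have "\<bar>\<phi> x\<bar> \<le> max C 0" for x
    using C[of x] K(2)[of x] by (cases "x \<in> K") auto
  then show ?thesis using that by blast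
qed

text \<open>The partial derivatives are continuous with compact support, hence bounded; the mean value
  inequality turns their bound into a global Lipschitz constant. That constant provides the dominating
  functions for all difference quotients below.\<close>

lemma test_function_derivative_bounded:
  assumes "\<phi> \<in> test_functions \<Omega>"
  obtains C where "0 \<le> C" "\<And>x h. \<bar>frechet_derivative \<phi> (at x) h\<bar> \<le> C * norm h"
    "\<And>x y. \<bar>\<phi> x - \<phi> y\<bar> \<le> C * norm (x - y)"
proof -
  have "\<exists>C. \<forall>x. \<bar>frechet_derivative \<phi> (at x) b\<bar> \<le> C" if "b \<in> Basis" for b
    using test_function_bounded[OF test_function_partial[OF assms that]] by metis
  then obtain C where C: "\<And>b x. b \<in> Basis \<Longrightarrow> \<bar>frechet_derivative \<phi> (at x) b\<bar> \<le> C b" by metis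
  have lin: "linear (frechet_derivative \<phi> (at x))" for x
    using has_derivative_linear[OF test_function_has_derivative[OF assms]] .
  have *: "\<bar>frechet_derivative \<phi> (at x) h\<bar> \<le> (\<Sum>b\<in>Basis. C b) * norm h" for x h
  proof -
    have "frechet_derivative \<phi> (at x) h = (\<Sum>b\<in>Basis. (h \<bullet> b) * frechet_derivative \<phi> (at x) b)"
      using linear_sum[OF lin, where g = "\<lambda>b. (h \<bullet> b) *\<^sub>R b" and S = Basis]
      by (simp add: euclidean_representation linear_cmul[OF lin])
    also have "\<bar>\<dots>\<bar> \<le> (\<Sum>b\<in>Basis. norm h * C b)"
      by (rule order_trans[OF sum_abs])
        (intro sum_mono, simp add: abs_mult, intro mult_mono Basis_le_norm C, auto)
    finally show ?thesis by (simp add: sum_distrib_left mult.commute)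
  qed
  have pos: "0 \<le> (\<Sum>b\<in>Basis. C b)" using C by (intro sum_nonneg) (meson abs_ge_zero order_trans)
  have "norm (\<phi> x - \<phi> y) \<le> (\<Sum>b\<in>Basis. C b) * norm (x - y)" for x y
    using test_function_has_derivative[OF assms] *
    by (intro differentiable_bound[of UNIV \<phi> "\<lambda>x. frechet_derivative \<phi> (at x)"])
       (auto intro!: onorm_bound[OF pos])
  then show ?thesis using that[OF pos *] by simp
qed

lemma test_function_measurable:
  assumes "\<phi> \<in> test_functions \<Omega>"
  shows "\<phi> \<in> borel_measurable borel" "\<phi> \<in> borel_measurable lebesgue"
    "\<phi> \<in> borel_measurable (lebesgue_on S)"
proof -
  show *: "\<phi> \<in> borel_measurable borel"
    using test_function_continuous[OF assms, of UNIV] by (rule borel_measurable_continuous_onI)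
  show "\<phi> \<in> borel_measurable lebesgue"
    using * by (simp add: measurable_completion)
  then show "\<phi> \<in> borel_measurable (lebesgue_on S)"
    by (rule measurable_restrict_space1)
qed

lemma integrable_mult_test_function:
  fixes h :: "'a::euclidean_space \<Rightarrow> real"
  assumes \<Omega>: "open \<Omega>" and h: "locally_integrable \<Omega> h" and \<phi>: "\<phi> \<in> test_functions \<Omega>"
  shows "integrable (lebesgue_on \<Omega>) (\<lambda>x. h x * \<phi> x)"
proof -
  obtain K where K: "compact K" "K \<subseteq> \<Omega>" "\<And>x. x \<notin> K \<Longrightarrow> \<phi> x = 0"
    using test_function_support[OF \<phi>] by metis
  obtain C where C: "\<And>x. \<bar>\<phi> x\<bar> \<le> C" using test_function_bounded[OF \<phi>] by blast
  have hK: "integrable lebesgue (\<lambda>x. indicator K x *\<^sub>R h x)"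
    using h K unfolding locally_integrable_def set_integrable_def by blast
  have "integrable lebesgue (\<lambda>x. (indicator K x *\<^sub>R h x) * \<phi> x)"
  proof (rule Bochner_Integration.integrable_bound)
    show "integrable lebesgue (\<lambda>x. C * (indicator K x *\<^sub>R h x))" using hK by auto
    show "(\<lambda>x. (indicator K x *\<^sub>R h x) * \<phi> x) \<in> borel_measurable lebesgue"
      using borel_measurable_integrable[OF hK] test_function_measurable(2)[OF \<phi>]
      by (rule borel_measurable_times)
    show "AE x in lebesgue. norm (indicator K x *\<^sub>R h x * \<phi> x) \<le> norm (C * (indicator K x *\<^sub>R h x))"
    proof (rule AE_I2)
      fix x
      have "0 \<le> C" using C[of x] by linarith
      then show "norm (indicator K x *\<^sub>R h x * \<phi> x) \<le> norm (C * (indicator K x *\<^sub>R h x))"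
        using C[of x] by (simp add: abs_mult mult.commute mult_mono mult_left_mono indicator_def)
    qed
  qed
  also have "(\<lambda>x. (indicator K x *\<^sub>R h x) * \<phi> x) = (\<lambda>x. indicator \<Omega> x *\<^sub>R (h x * \<phi> x))"
    using K by (auto simp: indicator_def fun_eq_iff)
  finally show ?thesis
    using \<Omega> by (subst integrable_restrict_space) auto
qed

text \<open>The open boxes form an intersection-stable generator of the Borel sets, so the integrals
  over all Borel sets vanish.\<close>

lemma integral_box_zero_imp_AE_zero:
  fixes f :: "'a::euclidean_space \<Rightarrow> real"
  assumes f: "integrable lborel f"
    and box: "\<And>c d. (\<integral>x. indicator (box c d) x * f x \<partial>lborel) = 0"
    and total: "(\<integral>x. f x \<partial>lborel) = 0"
  shows "AE x in lborel. f x = 0"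
proof (rule sigma_finite_measure.density_zero[OF sigma_finite_lborel f])
  fix A :: "'a set" assume "A \<in> sets lborel"
  then have A: "A \<in> sigma_sets UNIV (range (\<lambda>(a, b). box a b))"
    unfolding sets_lborel borel_eq_box by simp
  have int: "integrable lborel (\<lambda>x. indicator A x * f x)" if "A \<in> sets borel" for A
    using integrable_mult_indicator[of A lborel f] that f by simp
  have sets: "A \<in> sets borel" if "A \<in> sigma_sets UNIV (range (\<lambda>(a, b). box a b))" for A :: "'a set"
    using that unfolding borel_eq_box by simp
  have "(\<integral>x. indicator A x * f x \<partial>lborel) = 0"
  proof (rule sigma_sets_induct_disjoint[OF _ _ A])
    show "Int_stable (range (\<lambda>(a::'a, b). box a b))"
      by (force simp: Int_stable_def box_Int_box)
    show "(\<integral>x. indicator B x * f x \<partial>lborel) = 0" if "B \<in> range (\<lambda>(a, b). box a b)" for B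
      using that box by auto
  next
    fix B assume B: "B \<in> sigma_sets UNIV (range (\<lambda>(a::'a, b). box a b))"
      "(\<integral>x. indicator B x * f x \<partial>lborel) = 0"
    have "(\<lambda>x. indicator (UNIV - B) x * f x) = (\<lambda>x. f x - indicator B x * f x)"
      by (auto simp: indicator_def fun_eq_iff)
    then show "(\<integral>x. indicator (UNIV - B) x * f x \<partial>lborel) = 0"
      using B total f int[OF sets[OF B(1)]] by simp
  next
    fix B :: "nat \<Rightarrow> 'a set"
    assume dis: "disjoint_family B" and B: "range B \<subseteq> sigma_sets UNIV (range (\<lambda>(a, b). box a b))"
      and zero: "\<And>i. (\<integral>x. indicator (B i) x * f x \<partial>lborel) = 0"
    have B': "B i \<in> sets lborel" for i using sets B by auto
    then have "set_lebesgue_integral lborel (\<Union>i. B i) f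
        = (\<Sum>i. set_lebesgue_integral lborel (B i) f)"
      using f dis
      by (intro lebesgue_integral_countable_add)
         (auto simp: disjoint_family_on_def set_integrable_def
           intro!: integrable_mult_indicator int[simplified] sets.countable_UN)
    then show "(\<integral>x. indicator (\<Union>i. B i) x * f x \<partial>lborel) = 0"
      using zero by (simp add: set_lebesgue_integral_def)
  qed auto
  then show "set_lebesgue_integral lborel A f = 0" by (simp add: set_lebesgue_integral_def)
qed

text \<open>The bumps on the box converge boundedly to its indicator function. Requiring the closed
  box inside \<open>\<Omega>\<close> makes them test functions on \<open>\<Omega>\<close>.\<close>

lemma weakly_zero_on_box:
  fixes h :: "'a::euclidean_space \<Rightarrow> real"
  assumes \<Omega>: "open \<Omega>" and h: "locally_integrable \<Omega> h"
    and weak: "\<And>\<phi>. \<phi> \<in> test_functions \<Omega> \<Longrightarrow> (\<integral>x. h x * \<phi> x \<partial>lebesgue_on \<Omega>) = 0"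
    and ab: "cbox a b \<subseteq> \<Omega>"
  shows "(\<integral>x. indicator (box a b) x * h x \<partial>lebesgue) = 0"
proof (cases "box a b = {}")
  case False
  let ?h = "\<lambda>x. indicator (cbox a b) x *\<^sub>R h x"
  have int: "integrable lebesgue ?h"
    using h ab compact_cbox unfolding locally_integrable_def set_integrable_def by blast
  have bump: "box_bump (real (Suc k)) a b \<in> test_functions \<Omega>" for k
    using False ab by (intro box_bump_test_function) auto
  have "(\<lambda>k. \<integral>x. ?h x * box_bump (real (Suc k)) a b x \<partial>lebesgue)
      \<longlonglongrightarrow> (\<integral>x. ?h x * indicator (box a b) x \<partial>lebesgue)"
  proof (rule integral_dominated_convergence[where w = "\<lambda>x. norm (?h x)"])
    show "AE x in lebesgue. (\<lambda>k. ?h x * box_bump (real (Suc k)) a b x)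
        \<longlonglongrightarrow> ?h x * indicator (box a b) x"
      by (intro AE_I2 tendsto_intros box_bump_tendsto_indicator False)
    show "AE x in lebesgue. norm (?h x * box_bump (real (Suc k)) a b x) \<le> norm (?h x)" for k
      using box_bump_range[of "real (Suc k)" a b] by (intro AE_I2) (simp add: abs_mult mult_left_le)
    show "(\<lambda>x. ?h x * box_bump (real (Suc k)) a b x) \<in> borel_measurable lebesgue" for k
      using borel_measurable_integrable[OF int] test_function_measurable(2)[OF bump]
      by (rule borel_measurable_times)
    show "(\<lambda>x. ?h x * indicator (box a b) x) \<in> borel_measurable lebesgue"
      using borel_measurable_integrable[OF int]
      by (rule borel_measurable_times) (intro borel_measurable_indicator fmeasurableD lmeasurable_box)
  qed (use int in auto)
  moreover have "(\<integral>x. ?h x * box_bump (real (Suc k)) a b x \<partial>lebesgue) = 0" for k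
  proof -
    have "?h x * box_bump (real (Suc k)) a b x
        = indicator \<Omega> x *\<^sub>R (h x * box_bump (real (Suc k)) a b x)" for x
      using box_bump_outside[of "real (Suc k)" a b x] False ab box_subset_cbox[of a b]
      by (auto simp: indicator_def)
    then have "(\<integral>x. ?h x * box_bump (real (Suc k)) a b x \<partial>lebesgue)
        = (\<integral>x. indicator \<Omega> x *\<^sub>R (h x * box_bump (real (Suc k)) a b x) \<partial>lebesgue)"
      by (rule Bochner_Integration.integral_cong[OF refl])
    also have "\<dots> = 0"
      using weak[OF bump[of k]] \<Omega> by (subst (asm) integral_restrict_space) auto
    finally show ?thesis .
  qed
  ultimately have "(\<integral>x. ?h x * indicator (box a b) x \<partial>lebesgue) = 0"
    by (simp add: LIMSEQ_const_iff)
  moreover have "(\<lambda>x. ?h x * indicator (box a b) x) = (\<lambda>x. indicator (box a b) x * h x)"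
    using box_subset_cbox[of a b] by (auto simp: indicator_def fun_eq_iff)
  ultimately show ?thesis by simp
qed simp

text \<open>The fundamental lemma of the calculus of variations. On each closed box inside \<open>\<Omega>\<close> all
  integrals over smaller boxes vanish, hence so does the function almost everywhere there, and countably
  many such boxes cover \<open>\<Omega>\<close>.\<close>

lemma weakly_zero_imp_AE_zero:
  fixes h :: "'a::euclidean_space \<Rightarrow> real"
  assumes \<Omega>: "open \<Omega>" and h: "locally_integrable \<Omega> h"
    and weak: "\<And>\<phi>. \<phi> \<in> test_functions \<Omega> \<Longrightarrow> (\<integral>x. h x * \<phi> x \<partial>lebesgue_on \<Omega>) = 0"
  shows "AE x in lebesgue_on \<Omega>. h x = 0"
proof -
  have box: "AE x in lebesgue. x \<in> cbox a b \<longrightarrow> h x = 0" if ab: "cbox a b \<subseteq> \<Omega>" for a b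
  proof -
    let ?f = "\<lambda>x. indicator (box a b) x *\<^sub>R h x"
    have "integrable lebesgue (\<lambda>x. indicator (cbox a b) x *\<^sub>R h x)"
      using h ab compact_cbox unfolding locally_integrable_def set_integrable_def by blast
    from integrable_mult_indicator[OF fmeasurableD[OF lmeasurable_box] this]
    have "integrable lebesgue (\<lambda>x. indicator (box a b) x *\<^sub>R (indicator (cbox a b) x *\<^sub>R h x))" .
    also have "(\<lambda>x. indicator (box a b) x *\<^sub>R (indicator (cbox a b) x *\<^sub>R h x)) = ?f"
      using box_subset_cbox[of a b] by (auto simp: indicator_def fun_eq_iff)
    finally have int: "integrable lebesgue ?f" .
    \<comment> \<open>Boxes generate only the Borel sets, so the Lebesgue
      measurable function is replaced by a Borel one.\<close>
    obtain f where f: "f \<in> borel_measurable lborel" "AE x in lborel. ?f x = f x"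
      using completion_ex_borel_measurable_real[OF borel_measurable_integrable[OF int]] by auto
    have fL: "f \<in> borel_measurable lebesgue" using f(1) by (simp add: measurable_completion)
    have AE: "AE x in lebesgue. ?f x = f x" using f(2) by (rule AE_completion)
    have "integrable lebesgue f"
      using int by (rule integrable_cong_AE_imp) (use AE fL in \<open>auto elim: eventually_mono\<close>)
    then have intf: "integrable lborel f" using f(1) by (simp add: integrable_completion)
    have eq: "(\<integral>x. indicator A x * f x \<partial>lborel) = (\<integral>x. indicator A x * ?f x \<partial>lebesgue)"
      if "A \<in> sets borel" for A
    proof -
      have "(\<integral>x. indicator A x * f x \<partial>lborel) = (\<integral>x. indicator A x * f x \<partial>lebesgue)"
        using f(1) that by (subst integral_completion) auto
      also have "\<dots> = (\<integral>x. indicator A x * ?f x \<partial>lebesgue)"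
        using AE that fL borel_measurable_integrable[OF int]
          measurable_completion[OF borel_measurable_indicator[of A lborel]]
        by (intro integral_cong_AE) (auto intro!: borel_measurable_times elim!: eventually_mono)
      finally show ?thesis .
    qed
    have "AE x in lborel. f x = 0"
    proof (rule integral_box_zero_imp_AE_zero[OF intf])
      have sub: "(\<integral>x. indicator (box c d) x * h x \<partial>lebesgue) = 0" if "box c d \<subseteq> box a b" for c d
      proof (cases "box c d = {}")
        case False
        have "closure (box c d) \<subseteq> closure (box a b)" using that by (rule closure_mono)
        moreover have "box a b \<noteq> {}" using that False by auto
        ultimately        have "cbox c d \<subseteq> \<Omega>" using False ab by simp
        then show ?thesis using weakly_zero_on_box[OF \<Omega> h weak] by blast
      qed simp
      show "(\<integral>x. indicator (box c d) x * f x \<partial>lborel) = 0" for c d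
      proof -
        have "(\<lambda>x. indicator (box c d) x * ?f x) = (\<lambda>x. indicator (box c d \<inter> box a b) x * h x)"
          by (auto simp: indicator_def fun_eq_iff)
        moreover obtain p q where "box c d \<inter> box a b = box p q" using box_Int_box by blast
        moreover from this have "box p q \<subseteq> box a b" by blast
        ultimately show ?thesis using sub[of p q] by (simp add: eq)
      qed
      show "(\<integral>x. f x \<partial>lborel) = 0"
        using eq[of UNIV] sub[of a b] by simp
    qed
    then have "AE x in lebesgue. f x = 0" by (rule AE_completion)
    moreover have "AE x in lebesgue. x \<notin> cbox a b - box a b"
      using negligible_frontier_interval[of a b] by (intro AE_not_in) (simp add: negligible_iff_null_sets)
    ultimately show ?thesis using AE by eventually_elim (auto simp: indicator_def split: if_splits)
  qed
  obtain \<D> where \<D>: "countable \<D>" "\<D> \<subseteq> Pow \<Omega>" "\<And>X. X \<in> \<D> \<Longrightarrow> \<exists>a b. X = cbox a b" "\<Union>\<D> = \<Omega>"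
    using open_countable_Union_open_cbox[OF \<Omega>] by metis
  have "AE x in lebesgue. \<forall>X\<in>\<D>. x \<in> X \<longrightarrow> h x = 0"
  proof (subst AE_ball_countable[OF \<D>(1)], intro ballI)
    fix X assume X: "X \<in> \<D>"
    then obtain a b where "X = cbox a b" using \<D>(3) by blast
    then show "AE x in lebesgue. x \<in> X \<longrightarrow> h x = 0" using box[of a b] X \<D>(2) by auto
  qed
  then have "AE x in lebesgue. x \<in> \<Omega> \<longrightarrow> h x = 0"
    by eventually_elim (use \<D>(4) in auto)
  then show ?thesis using \<Omega> by (simp add: AE_restrict_space_iff)
qed

lemma locally_integrable_inner:
  assumes "locally_integrable \<Omega> g" shows "locally_integrable \<Omega> (\<lambda>x. g x \<bullet> b)"
  unfolding locally_integrable_def set_integrable_def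
proof (intro allI impI)
  fix K assume "compact K \<and> K \<subseteq> \<Omega>"
  then have "integrable lebesgue (\<lambda>x. indicator K x *\<^sub>R g x)"
    using assms unfolding locally_integrable_def set_integrable_def by blast
  then have "integrable lebesgue (\<lambda>x. (indicator K x *\<^sub>R g x) \<bullet> b)"
    by (rule integrable_inner_left)
  then show "integrable lebesgue (\<lambda>x. indicator K x *\<^sub>R (g x \<bullet> b))" by simp
qed

lemma has_weak_gradientD:
  assumes "has_weak_gradient \<Omega> u g"
  shows "locally_integrable \<Omega> u" "locally_integrable \<Omega> g"
    "\<phi> \<in> test_functions \<Omega> \<Longrightarrow> b \<in> Basis \<Longrightarrow>
      (\<integral>x. u x * frechet_derivative \<phi> (at x) b \<partial>lebesgue_on \<Omega>)
      = - (\<integral>x. (g x \<bullet> b) * \<phi> x \<partial>lebesgue_on \<Omega>)"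
  using assms unfolding has_weak_gradient_def by blast+

text \<open>\<open>weak_gradient\<close> is an arbitrary choice among the weak gradients; this lemma lets an
  explicit weak gradient stand in for the chosen one.\<close>

lemma weak_gradient_unique:
  fixes \<Omega> :: "'a::euclidean_space set"
  assumes \<Omega>: "open \<Omega>" and g: "has_weak_gradient \<Omega> u g" and g': "has_weak_gradient \<Omega> u g'"
  shows "AE x in lebesgue_on \<Omega>. g x = g' x"
proof -
  have loc: "locally_integrable \<Omega> (\<lambda>x. g x \<bullet> b)" "locally_integrable \<Omega> (\<lambda>x. g' x \<bullet> b)" for b
    using g g' by (blast intro: locally_integrable_inner has_weak_gradientD(2))+
  have "AE x in lebesgue_on \<Omega>. g x \<bullet> b - g' x \<bullet> b = 0" if b: "b \<in> Basis" for b
  proof (rule weakly_zero_imp_AE_zero[OF \<Omega>])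
    show "locally_integrable \<Omega> (\<lambda>x. g x \<bullet> b - g' x \<bullet> b)"
      using loc[of b] by (auto simp: locally_integrable_def intro: set_integral_diff)
    show "(\<integral>x. (g x \<bullet> b - g' x \<bullet> b) * \<phi> x \<partial>lebesgue_on \<Omega>) = 0" if \<phi>: "\<phi> \<in> test_functions \<Omega>" for \<phi>
    proof -
      have "(\<integral>x. (g x \<bullet> b) * \<phi> x \<partial>lebesgue_on \<Omega>) = (\<integral>x. (g' x \<bullet> b) * \<phi> x \<partial>lebesgue_on \<Omega>)"
        using has_weak_gradientD(3)[OF g \<phi> b] has_weak_gradientD(3)[OF g' \<phi> b] by simp
      then show ?thesis
        using integrable_mult_test_function[OF \<Omega> loc(1) \<phi>] integrable_mult_test_function[OF \<Omega> loc(2) \<phi>]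
        by (simp add: left_diff_distrib)
    qed
  qed
  then have "AE x in lebesgue_on \<Omega>. \<forall>b\<in>Basis. g x \<bullet> b - g' x \<bullet> b = 0"
    by (subst AE_ball_countable) (auto simp: countable_finite)
  then show ?thesis by eventually_elim (auto intro: euclidean_eqI)
qed


section \<open>Essentially bounded weak gradients and Lipschitz continuity\<close>

lemma weak_gradient_direction:
  fixes \<Omega> :: "'a::euclidean_space set"
  assumes \<Omega>: "open \<Omega>" and g: "has_weak_gradient \<Omega> u g" and \<phi>: "\<phi> \<in> test_functions \<Omega>"
  shows "(\<integral>x. u x * frechet_derivative \<phi> (at x) w \<partial>lebesgue_on \<Omega>)
       = - (\<integral>x. (g x \<bullet> w) * \<phi> x \<partial>lebesgue_on \<Omega>)"
proof -
  have lin: "linear (frechet_derivative \<phi> (at x))" for x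
    using has_derivative_linear[OF test_function_has_derivative[OF \<phi>]] .
  have 1: "u x * frechet_derivative \<phi> (at x) w
      = (\<Sum>b\<in>Basis. (w \<bullet> b) * (u x * frechet_derivative \<phi> (at x) b))" for x
    using linear_sum[OF lin, where g = "\<lambda>b. (w \<bullet> b) *\<^sub>R b" and S = Basis]
    by (simp add: euclidean_representation linear_cmul[OF lin] sum_distrib_left mult.left_commute)
  have 2: "(g x \<bullet> w) * \<phi> x = (\<Sum>b\<in>Basis. (w \<bullet> b) * ((g x \<bullet> b) * \<phi> x))" for x
    by (subst euclidean_inner) (simp add: sum_distrib_left sum_distrib_right mult_ac)
  have i1: "integrable (lebesgue_on \<Omega>) (\<lambda>x. u x * frechet_derivative \<phi> (at x) b)"
    if "b \<in> Basis" for b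
    by (rule integrable_mult_test_function[OF \<Omega> has_weak_gradientD(1)[OF g]
          test_function_partial[OF \<phi> that]])
  have i2: "integrable (lebesgue_on \<Omega>) (\<lambda>x. (g x \<bullet> b) * \<phi> x)" for b
    by (rule integrable_mult_test_function[OF \<Omega>
          locally_integrable_inner[OF has_weak_gradientD(2)[OF g]] \<phi>])
  show ?thesis
    unfolding 1 2 using i1 i2 has_weak_gradientD(3)[OF g \<phi>]
    by (simp add: Bochner_Integration.integral_sum sum_negf[symmetric])
qed

lemma bounded_open_finite_measure:
  assumes "open \<Omega>" "bounded \<Omega>" shows "finite_measure (lebesgue_on (\<Omega>::'a::euclidean_space set))"
  using assms by (intro finite_measure_lebesgue_on lmeasurable_open)

text \<open>Differentiation under the integral: the difference quotients of \<open>\<psi>\<close> along \<open>w\<close> are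
  bounded by the Lipschitz constant of \<open>\<psi>\<close>, and \<open>u\<close> is essentially bounded on a set of finite
  measure, so dominated convergence applies.\<close>

lemma integral_translated_test_function_has_derivative:
  fixes \<Omega> :: "'a::euclidean_space set"
  assumes \<Omega>: "open \<Omega>" "bounded \<Omega>" and u: "u \<in> borel_measurable (lebesgue_on \<Omega>)"
    and B: "AE x in lebesgue_on \<Omega>. \<bar>u x\<bar> \<le> B" and \<psi>: "\<psi> \<in> test_functions UNIV"
  shows "((\<lambda>s. \<integral>z. u z * \<psi> (z - (x + s *\<^sub>R w)) \<partial>lebesgue_on \<Omega>) has_real_derivative
      - (\<integral>z. u z * frechet_derivative \<psi> (at (z - (x + s *\<^sub>R w))) w \<partial>lebesgue_on \<Omega>)) (at s)"
proof -
  interpret finite_measure "lebesgue_on \<Omega>" using bounded_open_finite_measure[OF \<Omega>] .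
  obtain C where C: "0 \<le> C" "\<And>x y. \<bar>\<psi> x - \<psi> y\<bar> \<le> C * norm (x - y)"
    using test_function_derivative_bounded[OF \<psi>] by metis
  obtain M where M: "\<And>x. \<bar>\<psi> x\<bar> \<le> M" using test_function_bounded[OF \<psi>] by blast
  define V where "V s = (\<integral>z. u z * \<psi> (z - (x + s *\<^sub>R w)) \<partial>lebesgue_on \<Omega>)" for s
  define D where "D z = - frechet_derivative \<psi> (at (z - (x + s *\<^sub>R w))) w" for z
  have shift: "(\<lambda>z. \<psi> (z - c)) \<in> borel_measurable (lebesgue_on \<Omega>)" for c
    using test_function_continuous[OF \<psi>, of UNIV] \<Omega>
    by (intro continuous_imp_measurable_on_sets_lebesgue) (auto intro!: continuous_intros continuous_on_compose2[of UNIV \<psi>])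
  have um: "(\<lambda>z. u z * \<psi> (z - c)) \<in> borel_measurable (lebesgue_on \<Omega>)" for c
    using u shift by (rule borel_measurable_times)
  have int: "integrable (lebesgue_on \<Omega>) (\<lambda>z. u z * \<psi> (z - c))" for c
  proof (rule integrable_const_bound[OF _ um])
    show "AE z in lebesgue_on \<Omega>. norm (u z * \<psi> (z - c)) \<le> B * M"
      using B by eventually_elim (auto simp: abs_mult intro!: mult_mono M)
  qed
  have DQ: "((\<lambda>y. (\<psi> (z - (x + y *\<^sub>R w)) - \<psi> (z - (x + s *\<^sub>R w))) / (y - s)) \<longlongrightarrow> D z) (at s)" for z
  proof -
    have "((\<lambda>y. z - (x + y *\<^sub>R w)) has_derivative (\<lambda>h. - (h *\<^sub>R w))) (at s)"
      by (auto intro!: derivative_eq_intros)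
    from has_derivative_compose[OF this test_function_has_derivative[OF \<psi>]]
    have "((\<lambda>y. \<psi> (z - (x + y *\<^sub>R w))) has_derivative
        (\<lambda>h. frechet_derivative \<psi> (at (z - (x + s *\<^sub>R w))) (- (h *\<^sub>R w)))) (at s)" .
    moreover have "(\<lambda>h. frechet_derivative \<psi> (at (z - (x + s *\<^sub>R w))) (- (h *\<^sub>R w))) = (*) (D z)"
      using has_derivative_linear[OF test_function_has_derivative[OF \<psi>], of "z - (x + s *\<^sub>R w)"]
      by (simp add: D_def fun_eq_iff linear_neg linear_cmul)
    ultimately have "((\<lambda>y. \<psi> (z - (x + y *\<^sub>R w))) has_real_derivative D z) (at s)"
      by (simp add: has_field_derivative_def)
    then show ?thesis by (simp add: has_field_derivative_iff)
  qed
  have "((\<lambda>y. (V y - V s) / (y - s)) \<longlongrightarrow> (\<integral>z. u z * D z \<partial>lebesgue_on \<Omega>)) (at s)"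
    unfolding tendsto_at_iff_sequentially comp_def
  proof (intro allI impI)
    fix X :: "nat \<Rightarrow> real" assume X: "\<forall>i. X i \<in> UNIV - {s}" "X \<longlonglongrightarrow> s"
    define q where "q i z = (\<psi> (z - (x + X i *\<^sub>R w)) - \<psi> (z - (x + s *\<^sub>R w))) / (X i - s)" for i z
    have qm: "q i \<in> borel_measurable (lebesgue_on \<Omega>)" for i
      unfolding q_def by (intro borel_measurable_divide borel_measurable_diff shift) auto
    have qD: "(\<lambda>i. q i z) \<longlonglongrightarrow> D z" for z
      using DQ[of z] X unfolding q_def tendsto_at_iff_sequentially comp_def by blast
    have qC: "\<bar>q i z\<bar> \<le> C * norm w" for i z
    proof -
      have "\<bar>\<psi> (z - (x + X i *\<^sub>R w)) - \<psi> (z - (x + s *\<^sub>R w))\<bar> \<le> C * norm ((s - X i) *\<^sub>R w)"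
        using C(2)[of "z - (x + X i *\<^sub>R w)" "z - (x + s *\<^sub>R w)"] by (simp add: algebra_simps)
      also have "\<dots> = C * norm w * \<bar>X i - s\<bar>" by (simp add: abs_minus_commute)
      finally show ?thesis
        using X(1) by (simp add: q_def pos_divide_le_eq)
    qed
    have "(V (X i) - V s) / (X i - s) = (\<integral>z. u z * q i z \<partial>lebesgue_on \<Omega>)" for i
    proof -
      have "V (X i) - V s = (\<integral>z. u z * \<psi> (z - (x + X i *\<^sub>R w)) - u z * \<psi> (z - (x + s *\<^sub>R w)) \<partial>lebesgue_on \<Omega>)"
        unfolding V_def using int by (simp add: Bochner_Integration.integral_diff)
      then show ?thesis by (simp add: q_def right_diff_distrib[symmetric] del: integral_divide_zero flip: integral_divide_zero)
    qed
    moreover have "(\<lambda>i. \<integral>z. u z * q i z \<partial>lebesgue_on \<Omega>) \<longlonglongrightarrow> (\<integral>z. u z * D z \<partial>lebesgue_on \<Omega>)"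
    proof (rule integral_dominated_convergence[where w = "\<lambda>_. B * (C * norm w)"])
      show "(\<lambda>z. u z * D z) \<in> borel_measurable (lebesgue_on \<Omega>)"
        by (intro borel_measurable_times u borel_measurable_LIMSEQ_real[OF qD qm])
      show "AE z in lebesgue_on \<Omega>. norm (u z * q i z) \<le> B * (C * norm w)" for i
        using B by eventually_elim (auto simp: abs_mult intro!: mult_mono qC)
    qed (auto intro!: u qm borel_measurable_times tendsto_intros qD)
    ultimately show "(\<lambda>i. (V (X i) - V s) / (X i - s)) \<longlonglongrightarrow> (\<integral>z. u z * D z \<partial>lebesgue_on \<Omega>)" by simp
  qed
  then show ?thesis
    unfolding has_field_derivative_iff V_def by (simp add: D_def)
qed

lemma integral_translation:
  fixes f :: "'a::euclidean_space \<Rightarrow> real"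
  assumes [measurable]: "f \<in> borel_measurable borel"
  shows "(\<integral>z. f (z + c) \<partial>lborel) = (\<integral>z. f z \<partial>lborel)"
proof -
  have "(\<integral>z. f z \<partial>lborel) = (\<integral>z. f z \<partial>distr lborel borel ((+) c))"
    by (simp add: lborel_distr_plus)
  also have "\<dots> = (\<integral>z. f (c + z) \<partial>lborel)" by (rule integral_distr) auto
  finally show ?thesis by (simp add: add.commute)
qed

lemma integral_mult_test_function_lborel:
  fixes f :: "'a::euclidean_space \<Rightarrow> real"
  assumes \<Omega>: "open \<Omega>" and f: "f \<in> borel_measurable borel" and \<phi>: "\<phi> \<in> test_functions \<Omega>"
  shows "(\<integral>x. f x * \<phi> x \<partial>lebesgue_on \<Omega>) = (\<integral>x. f x * \<phi> x \<partial>lborel)"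
proof -
  have "(\<integral>x. f x * \<phi> x \<partial>lebesgue_on \<Omega>) = (\<integral>x. indicator \<Omega> x *\<^sub>R (f x * \<phi> x) \<partial>lebesgue)"
    using \<Omega> by (subst integral_restrict_space) auto
  also have "(\<lambda>x. indicator \<Omega> x *\<^sub>R (f x * \<phi> x)) = (\<lambda>x. f x * \<phi> x)"
    using test_function_zero[OF \<phi>] by (auto simp: indicator_def fun_eq_iff)
  finally show ?thesis
    using f test_function_measurable(1)[OF \<phi>] by (simp add: integral_completion)
qed

lemma integral_test_function_lborel:
  assumes "open \<Omega>" and "\<phi> \<in> test_functions \<Omega>"
  shows "(\<integral>x. \<phi> x \<partial>lebesgue_on \<Omega>) = (\<integral>x. \<phi> x \<partial>lborel)"
  using integral_mult_test_function_lborel[OF assms(1) _ assms(2), of "\<lambda>_. 1"] by simp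

lemma integrable_test_function:
  fixes \<Omega> :: "'a::euclidean_space set"
  assumes \<Omega>: "open \<Omega>" "bounded \<Omega>" and \<phi>: "\<phi> \<in> test_functions \<Omega>'"
  shows "integrable (lebesgue_on \<Omega>) \<phi>"
proof -
  interpret finite_measure "lebesgue_on \<Omega>" using bounded_open_finite_measure[OF \<Omega>] .
  obtain C where "\<And>x. \<bar>\<phi> x\<bar> \<le> C" using test_function_bounded[OF \<phi>] by blast
  then show ?thesis
    by (intro integrable_const_bound[where B = C] test_function_measurable(3)[OF \<phi>]) auto
qed

text \<open>Moving the kernel along the segment from \<open>x\<close> to \<open>y\<close> produces a differentiable function of the
  parameter whose derivative is an integral of \<open>u\<close> against a directional derivative of the kernel.
  The weak gradient turns it into an integral of \<open>g \<bullet> (y - x)\<close> against the kernel itself, which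
  the bound on \<open>g\<close> controls; the mean value inequality concludes.\<close>

lemma mollified_lipschitz:
  fixes \<Omega> :: "'a::euclidean_space set"
  assumes \<Omega>: "open \<Omega>" "bounded \<Omega>" and u: "u \<in> borel_measurable (lebesgue_on \<Omega>)"
    and B: "AE x in lebesgue_on \<Omega>. \<bar>u x\<bar> \<le> B" and g: "has_weak_gradient \<Omega> u g"
    and L: "AE x in lebesgue_on \<Omega>. norm (g x) \<le> L"
    and \<psi>: "\<psi> \<in> test_functions UNIV" "\<And>z. 0 \<le> \<psi> z"
    and seg: "\<And>s. s \<in> {0..1} \<Longrightarrow> (\<lambda>z. \<psi> (z - (x + s *\<^sub>R (y - x)))) \<in> test_functions \<Omega>"
  shows "\<bar>(\<integral>z. u z * \<psi> (z - y) \<partial>lebesgue_on \<Omega>) - (\<integral>z. u z * \<psi> (z - x) \<partial>lebesgue_on \<Omega>)\<bar>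
      \<le> L * norm (y - x) * (\<integral>z. \<psi> z \<partial>lborel)"
proof -
  let ?w = "y - x"
  define V where "V s = (\<integral>z. u z * \<psi> (z - (x + s *\<^sub>R ?w)) \<partial>lebesgue_on \<Omega>)" for s
  let ?V' = "\<lambda>s. - (\<integral>z. u z * frechet_derivative \<psi> (at (z - (x + s *\<^sub>R ?w))) ?w \<partial>lebesgue_on \<Omega>)"
  have der: "(V has_real_derivative ?V' s) (at s)" for s
    unfolding V_def by (rule integral_translated_test_function_has_derivative[OF \<Omega> u B \<psi>(1)])
  have bound: "\<bar>?V' s\<bar> \<le> L * norm ?w * (\<integral>z. \<psi> z \<partial>lborel)" if s: "s \<in> {0..1}" for s
  proof -
    let ?\<phi> = "\<lambda>z. \<psi> (z - (x + s *\<^sub>R ?w))"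
    note \<phi> = seg[OF s]
    have "frechet_derivative ?\<phi> (at z) = frechet_derivative \<psi> (at (z - (x + s *\<^sub>R ?w)))" for z
    proof (rule frechet_derivative_eqI)
      have "((\<lambda>z. z - (x + s *\<^sub>R ?w)) has_derivative (\<lambda>h. h)) (at z)"
        by (auto intro!: derivative_eq_intros)
      from has_derivative_compose[OF this test_function_has_derivative[OF \<psi>(1)]]
      show "(?\<phi> has_derivative frechet_derivative \<psi> (at (z - (x + s *\<^sub>R ?w)))) (at z)" .
    qed
    then have "?V' s = (\<integral>z. (g z \<bullet> ?w) * ?\<phi> z \<partial>lebesgue_on \<Omega>)"
      using weak_gradient_direction[OF \<Omega>(1) g \<phi>, of ?w] by simp
    also have "\<bar>\<dots>\<bar> \<le> (\<integral>z. (L * norm ?w) * ?\<phi> z \<partial>lebesgue_on \<Omega>)"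
    proof (rule order_trans[OF integral_abs_bound integral_mono_AE])
      show "integrable (lebesgue_on \<Omega>) (\<lambda>z. \<bar>(g z \<bullet> ?w) * ?\<phi> z\<bar>)"
        by (intro integrable_abs integrable_mult_test_function[OF \<Omega>(1)
          locally_integrable_inner[OF has_weak_gradientD(2)[OF g]] \<phi>])
      show "integrable (lebesgue_on \<Omega>) (\<lambda>z. (L * norm ?w) * ?\<phi> z)"
        by (intro integrable_mult_right integrable_test_function[OF \<Omega> \<phi>])
      show "AE z in lebesgue_on \<Omega>. \<bar>(g z \<bullet> ?w) * ?\<phi> z\<bar> \<le> (L * norm ?w) * ?\<phi> z"
        using L
      proof eventually_elim
        case (elim z)
        have "\<bar>g z \<bullet> ?w\<bar> \<le> L * norm ?w"
          using Cauchy_Schwarz_ineq2[of "g z" ?w] mult_right_mono[OF elim norm_ge_zero[of ?w]] by linarith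
        then show ?case using \<psi>(2) by (simp add: abs_mult mult_right_mono)
      qed
    qed
    also have "\<dots> = L * norm ?w * (\<integral>z. ?\<phi> z \<partial>lborel)"
      using integral_test_function_lborel[OF \<Omega>(1) \<phi>] by simp
    also have "(\<integral>z. ?\<phi> z \<partial>lborel) = (\<integral>z. \<psi> z \<partial>lborel)"
      using integral_translation[OF test_function_measurable(1)[OF \<psi>(1)], of "- (x + s *\<^sub>R ?w)"]
      by (simp only: add_uminus_conv_diff)
    finally show ?thesis .
  qed
  have "norm (V 1 - V 0) \<le> (L * norm ?w * (\<integral>z. \<psi> z \<partial>lborel)) * norm (1 - 0 :: real)"
    by (rule field_differentiable_bound[of "{0..1}" V ?V'])
      (use der bound in \<open>auto intro: has_field_derivative_at_within\<close>)
  then show ?thesis by (simp add: V_def)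
qed

text \<open>Mollify with a bump of small width and compare: up to a small multiple of the mass \<open>J\<close> of the
  bump, the mollified values at the endpoints are \<open>J\<close> times the values of the continuous
  representative, and the mollification satisfies the Lipschitz bound with constant \<open>L * J\<close>.\<close>

lemma essentially_lipschitz_on_segment:
  fixes \<Omega> :: "'a::euclidean_space set"
  assumes \<Omega>: "open \<Omega>" "bounded \<Omega>" and u: "u \<in> borel_measurable (lebesgue_on \<Omega>)"
    and B: "AE x in lebesgue_on \<Omega>. \<bar>u x\<bar> \<le> B" and g: "has_weak_gradient \<Omega> u g"
    and L: "AE x in lebesgue_on \<Omega>. norm (g x) \<le> L"
    and v: "continuous_on \<Omega> v" "AE x in lebesgue_on \<Omega>. v x = u x"
    and seg: "closed_segment x y \<subseteq> \<Omega>"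
  shows "\<bar>v y - v x\<bar> \<le> L * norm (y - x)"
proof (rule field_le_epsilon)
  fix e :: real assume "0 < e"
  then have e2: "0 < e / 2" by simp
  have xy: "x \<in> \<Omega>" "y \<in> \<Omega>" using seg by auto
  obtain r where r: "0 < r" "(\<Union>c\<in>closed_segment x y. ball c r) \<subseteq> \<Omega>"
    using compact_subset_open_imp_ball_epsilon_subset[OF compact_segment \<Omega>(1) seg] .
  have "\<exists>d>0. \<forall>z\<in>\<Omega>. dist z c < d \<longrightarrow> dist (v z) (v c) < e / 2" if "c \<in> \<Omega>" for c
    using v(1)[unfolded continuous_on_iff, rule_format, OF that e2] .
  then obtain d where d: "\<And>c. c \<in> \<Omega> \<Longrightarrow> 0 < d c"
    "\<And>c z. c \<in> \<Omega> \<Longrightarrow> z \<in> \<Omega> \<Longrightarrow> dist z c < d c \<Longrightarrow> dist (v z) (v c) < e / 2" by metis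
  \<comment> \<open>The half-width of the cube is chosen so that its radius, at most the
    dimension times \<open>\<delta>\<close>, stays below \<open>r\<close>, \<open>d x\<close> and \<open>d y\<close>.\<close>
  define \<delta> where "\<delta> = min r (min (d x) (d y)) / (2 * real DIM('a))"
  have \<delta>: "0 < \<delta>" using r d xy by (simp add: \<delta>_def)
  define \<psi> where "\<psi> = box_bump 1 (- \<delta> *\<^sub>R One) (\<delta> *\<^sub>R (One::'a))"
  have ne: "box (c - \<delta> *\<^sub>R One) (c + \<delta> *\<^sub>R One) \<noteq> {}" for c :: 'a
    using \<delta> by (auto simp: box_ne_empty inner_diff_left inner_add_left)
  have \<psi>_shift: "(\<lambda>z. \<psi> (z - c)) = box_bump 1 (c - \<delta> *\<^sub>R One) (c + \<delta> *\<^sub>R One)" for c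
    by (simp add: \<psi>_def box_bump_def fun_eq_iff inner_diff_left inner_add_left algebra_simps)
  have near: "dist z c < min r (min (d x) (d y))" if "z \<in> cbox (c - \<delta> *\<^sub>R One) (c + \<delta> *\<^sub>R One)" for z c :: 'a
  proof -
    have coord: "\<bar>(z - c) \<bullet> i\<bar> \<le> \<delta>" if "i \<in> Basis" for i
      using that \<open>z \<in> _\<close> by (auto simp: mem_box inner_diff_left inner_add_left abs_le_iff algebra_simps dest!: bspec)
    have "norm (z - c) \<le> (\<Sum>i\<in>Basis. \<bar>(z - c) \<bullet> i\<bar>)" by (rule norm_le_l1)
    also have "\<dots> \<le> (\<Sum>i\<in>(Basis::'a set). \<delta>)" by (rule sum_mono) (rule coord)
    also have "\<dots> = min r (min (d x) (d y)) / 2" by (simp add: \<delta>_def)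
    also have "\<dots> < min r (min (d x) (d y))"
    proof -
      have "0 < min r (min (d x) (d y))" using r(1) d(1) xy by simp
      then show ?thesis by linarith
    qed
    finally show ?thesis by (simp add: dist_norm)
  qed
  have test: "(\<lambda>z. \<psi> (z - c)) \<in> test_functions \<Omega>" if "c \<in> closed_segment x y" for c
    unfolding \<psi>_shift
  proof (rule box_bump_test_function[OF _ ne])
    show "cbox (c - \<delta> *\<^sub>R One) (c + \<delta> *\<^sub>R One) \<subseteq> \<Omega>"
      using near[of _ c] r(2) that by (force simp: dist_commute)
  qed simp
  have test0: "\<psi> \<in> test_functions UNIV"
    unfolding \<psi>_def using box_bump_test_function[OF _ ne[of 0], of 1 UNIV] by simp
  have \<psi>0: "0 \<le> \<psi> z" for z by (simp add: \<psi>_def box_bump_range)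
  define J where "J = (\<integral>z. \<psi> z \<partial>lborel)"
  have J_shift: "(\<integral>z. \<psi> (z - c) \<partial>lebesgue_on \<Omega>) = J" if "c \<in> closed_segment x y" for c
    using integral_test_function_lborel[OF \<Omega>(1) test[OF that]]
      integral_translation[OF test_function_measurable(1)[OF test0], of "- c"] by (simp add: J_def)
  have int: "integrable (lebesgue_on \<Omega>) (\<lambda>z. \<psi> (z - c))" if "c \<in> closed_segment x y" for c
    by (rule integrable_test_function[OF \<Omega> test[OF that]])
  have J: "0 < J"
  proof -
    have "0 \<le> J" unfolding J_def using \<psi>0 by simp
    moreover have "J \<noteq> 0"
    proof
      assume "J = 0"
      then have "AE z in lebesgue_on \<Omega>. \<psi> (z - x) = 0"
        using integral_nonneg_eq_0_iff_AE[OF int[of x]] J_shift[of x] \<psi>0 by auto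
      then have "AE z in lebesgue. z \<in> \<Omega> \<longrightarrow> \<psi> (z - x) = 0"
        using \<Omega> by (simp add: AE_restrict_space_iff)
      moreover have "z \<in> \<Omega> \<and> \<psi> (z - x) \<noteq> 0" if "z \<in> box (x - \<delta> *\<^sub>R One) (x + \<delta> *\<^sub>R One)" for z
      proof -
        have "\<psi> (z - x) \<noteq> 0"
          using box_bump_pos[OF zero_less_one that] fun_cong[OF \<psi>_shift[of x], of z] by simp
        then show ?thesis using test_function_zero[OF test[of x], of z] by auto
      qed
      ultimately have "negligible (box (x - \<delta> *\<^sub>R One) (x + \<delta> *\<^sub>R One))"
        unfolding eventually_ae_filter_negligible by (blast intro: negligible_subset)
      then show False using open_not_negligible[OF open_box ne] by blast
    qed
    ultimately show ?thesis by simp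
  qed
  have int_u: "integrable (lebesgue_on \<Omega>) (\<lambda>z. u z * \<psi> (z - c))" if "c \<in> closed_segment x y" for c
    by (rule integrable_mult_test_function[OF \<Omega>(1) has_weak_gradientD(1)[OF g] test[OF that]])
  have approx: "\<bar>(\<integral>z. u z * \<psi> (z - c) \<partial>lebesgue_on \<Omega>) - v c * J\<bar> \<le> e / 2 * J" if c: "c \<in> {x, y}" for c
  proof -
    have cs: "c \<in> closed_segment x y" "c \<in> \<Omega>" using c xy by auto
    have "(\<integral>z. u z * \<psi> (z - c) \<partial>lebesgue_on \<Omega>) - v c * J
        = (\<integral>z. u z * \<psi> (z - c) - v c * \<psi> (z - c) \<partial>lebesgue_on \<Omega>)"
      using int_u[OF cs(1)] int[OF cs(1)] J_shift[OF cs(1)] by simp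
    also have "\<bar>\<dots>\<bar> \<le> (\<integral>z. e / 2 * \<psi> (z - c) \<partial>lebesgue_on \<Omega>)"
    proof (rule order_trans[OF integral_abs_bound integral_mono_AE])
      show "AE z in lebesgue_on \<Omega>. \<bar>u z * \<psi> (z - c) - v c * \<psi> (z - c)\<bar> \<le> e / 2 * \<psi> (z - c)"
      proof (rule lebesgue_on_mono[OF v(2)])
        fix z assume z: "v z = u z" "z \<in> \<Omega>"
        show "\<bar>u z * \<psi> (z - c) - v c * \<psi> (z - c)\<bar> \<le> e / 2 * \<psi> (z - c)"
        proof (cases "\<psi> (z - c) = 0")
          case False
          then have "z \<in> box (c - \<delta> *\<^sub>R One) (c + \<delta> *\<^sub>R One)"
            using fun_cong[OF \<psi>_shift[of c], of z] box_bump_outside[OF zero_less_one ne] by metis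
          then have "dist z c < d c" using near[of z c] c box_subset_cbox by fastforce
          then have "\<bar>u z - v c\<bar> \<le> e / 2" using d(2)[OF cs(2) z(2)] z(1) by (simp add: dist_real_def)
          from mult_right_mono[OF this \<psi>0[of "z - c"]] show ?thesis
            using \<psi>0[of "z - c"] by (simp add: left_diff_distrib[symmetric] abs_mult)
        qed simp
      qed
    qed (use int_u[OF cs(1)] int[OF cs(1)] in auto)
    also have "\<dots> = e / 2 * J" using J_shift[OF cs(1)] by simp
    finally show ?thesis .
  qed
  have "\<bar>(\<integral>z. u z * \<psi> (z - y) \<partial>lebesgue_on \<Omega>) - (\<integral>z. u z * \<psi> (z - x) \<partial>lebesgue_on \<Omega>)\<bar>
      \<le> L * norm (y - x) * J"
    unfolding J_def
  proof (rule mollified_lipschitz[OF \<Omega> u B g L test0 \<psi>0 test])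
    show "x + s *\<^sub>R (y - x) \<in> closed_segment x y" if "s \<in> {0..1}" for s
      using that by (auto simp: in_segment algebra_simps intro!: exI[of _ s])
  qed
  moreover have "\<bar>q' - q\<bar> \<le> m + n"
    if "\<bar>p' - p\<bar> \<le> m" "\<bar>p - q\<bar> \<le> n / 2" "\<bar>p' - q'\<bar> \<le> n / 2" for p p' q q' m n :: real
    using that by linarith
  ultimately have "\<bar>v y * J - v x * J\<bar> \<le> L * norm (y - x) * J + e * J"
    using approx[of x] approx[of y] by simp
  then have "\<bar>v y - v x\<bar> * J \<le> (L * norm (y - x) + e) * J"
    using J by (simp add: abs_mult left_diff_distrib[symmetric] distrib_right)
  then show "\<bar>v y - v x\<bar> \<le> L * norm (y - x) + e"
    using J by simp
qed


section \<open>Nearest points are unique almost everywhere\<close>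

definition nearest_points :: "'a::euclidean_space set \<Rightarrow> 'a \<Rightarrow> 'a set" where
  "nearest_points F x = {y \<in> F. dist x y = infdist x F}"

text \<open>The extremal height of the nearest points in direction \<open>e\<close>. In contrast to a choice of a
  nearest point it is visibly Borel measurable, and the nearest point is unique as soon as the heights
  in the directions \<open>b\<close> and \<open>-b\<close> are opposite for every basis vector \<open>b\<close>.\<close>

definition nearest_height :: "'a::euclidean_space set \<Rightarrow> 'a \<Rightarrow> 'a \<Rightarrow> real" where
  "nearest_height F e x = Sup ((\<lambda>y. y \<bullet> e) ` nearest_points F x)"

lemma nearest_height_attained:
  fixes F :: "'a::euclidean_space set"
  assumes F: "compact F" "F \<noteq> {}"
  obtains y where "y \<in> nearest_points F x" "y \<bullet> e = nearest_height F e x"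
    "\<And>y'. y' \<in> nearest_points F x \<Longrightarrow> y' \<bullet> e \<le> nearest_height F e x"
proof -
  have "nearest_points F x = F \<inter> {y. dist x y = infdist x F}" by (auto simp: nearest_points_def)
  moreover have "closed {y. dist x y = infdist x F}"
    by (intro closed_Collect_eq continuous_intros)
  ultimately have "compact (nearest_points F x)" using F(1) by (simp add: compact_Int_closed)
  moreover have "nearest_points F x \<noteq> {}"
  proof -
    obtain y where "y \<in> F" "infdist x F = dist x y"
      using infdist_attains_inf[OF compact_imp_closed[OF F(1)] F(2)] .
    then have "y \<in> nearest_points F x" by (simp add: nearest_points_def)
    then show ?thesis by blast
  qed
  moreover have "continuous_on (nearest_points F x) (\<lambda>y. y \<bullet> e)" by (intro continuous_intros)
  ultimately obtain y where y: "y \<in> nearest_points F x"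
    "\<And>y'. y' \<in> nearest_points F x \<Longrightarrow> y' \<bullet> e \<le> y \<bullet> e"
    using continuous_attains_sup[of "nearest_points F x" "\<lambda>y. y \<bullet> e"] by blast
  then have "nearest_height F e x = y \<bullet> e"
    unfolding nearest_height_def by (intro cSup_eq_maximum) auto
  then show ?thesis using that[OF y(1)] y(2) by simp
qed

text \<open>The function is upper semicontinuous: its superlevel sets are projections of closed sets
  along the compact set \<open>F\<close>.\<close>

lemma nearest_height_measurable:
  fixes F :: "'a::euclidean_space set"
  assumes F: "compact F" "F \<noteq> {}"
  shows "nearest_height F e \<in> borel_measurable borel"
  unfolding borel_measurable_iff_ge
proof
  fix c :: real
  let ?T = "{p :: 'a \<times> 'a. dist (snd p) (fst p) \<le> infdist (snd p) F \<and> c \<le> fst p \<bullet> e}"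
  have "{x \<in> space borel. c \<le> nearest_height F e x} = {x. \<exists>y. y \<in> F \<and> (y, x) \<in> ?T}"
  proof (intro set_eqI iffI)
    fix x assume "x \<in> {x \<in> space borel. c \<le> nearest_height F e x}"
    moreover obtain y where "y \<in> nearest_points F x" "y \<bullet> e = nearest_height F e x"
      using nearest_height_attained[OF F] by metis
    ultimately show "x \<in> {x. \<exists>y. y \<in> F \<and> (y, x) \<in> ?T}" by (auto simp: nearest_points_def)
  next
    fix x assume "x \<in> {x. \<exists>y. y \<in> F \<and> (y, x) \<in> ?T}"
    then obtain y where y: "y \<in> F" "dist x y \<le> infdist x F" "c \<le> y \<bullet> e" by auto
    then have "y \<in> nearest_points F x"
      using infdist_le[OF y(1), of x] by (simp add: nearest_points_def)
    then have "y \<bullet> e \<le> nearest_height F e x"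
      using nearest_height_attained[OF F] by metis
    then show "x \<in> {x \<in> space borel. c \<le> nearest_height F e x}" using y(3) by simp
  qed
  moreover have "closed {x. \<exists>y. y \<in> F \<and> (y, x) \<in> ?T}"
    by (intro closed_compact_projection F(1) closed_Collect_conj closed_Collect_le continuous_intros)
  ultimately show "{x \<in> space borel. c \<le> nearest_height F e x} \<in> sets borel" by simp
qed

text \<open>The nearest point map is monotone: each of the two points is at least as close to its own
  foot as to the other one, and adding the two squared inequalities leaves only the mixed terms.\<close>

lemma nearest_points_monotone:
  fixes b :: "'a::euclidean_space"
  assumes y: "y \<in> nearest_points F x" and y': "y' \<in> nearest_points F (x + t *\<^sub>R b)" and t: "0 < t"
  shows "y \<bullet> b \<le> y' \<bullet> b"
proof -
  have "dist x y \<le> dist x y'" "dist (x + t *\<^sub>R b) y' \<le> dist (x + t *\<^sub>R b) y"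
    using y y' infdist_le[of y' F x] infdist_le[of y F "x + t *\<^sub>R b"] by (auto simp: nearest_points_def)
  then have "(dist x y)\<^sup>2 \<le> (dist x y')\<^sup>2" "(dist (x + t *\<^sub>R b) y')\<^sup>2 \<le> (dist (x + t *\<^sub>R b) y)\<^sup>2"
    by (auto intro: power_mono)
  then have "t * (y \<bullet> b) \<le> t * (y' \<bullet> b)"
    by (simp add: dist_norm power2_norm_eq_inner algebra_simps inner_commute)
  then show ?thesis using t by simp
qed

lemma integrable_bounded_mult_compact_support:
  fixes f \<phi> :: "'a::euclidean_space \<Rightarrow> real"
  assumes f: "f \<in> borel_measurable borel" "\<And>x. \<bar>f x\<bar> \<le> B"
    and \<phi>: "continuous_on UNIV \<phi>" "\<And>x. R < norm x \<Longrightarrow> \<phi> x = 0"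
  shows "integrable lborel (\<lambda>x. f x * \<phi> x)"
proof (rule Bochner_Integration.integrable_bound)
  have "integrable lborel (\<lambda>x. indicator (cball 0 R) x *\<^sub>R \<phi> x)"
    using \<phi>(1) by (intro borel_integrable_compact) (auto intro: continuous_on_subset)
  then show "integrable lborel (\<lambda>x. B * (indicator (cball 0 R) x *\<^sub>R \<phi> x))" by simp
  show "(\<lambda>x. f x * \<phi> x) \<in> borel_measurable lborel"
    using f(1) borel_measurable_continuous_onI[OF \<phi>(1)] by simp
  show "AE x in lborel. norm (f x * \<phi> x) \<le> norm (B * (indicator (cball 0 R) x *\<^sub>R \<phi> x))"
  proof (rule AE_I2)
    fix x show "norm (f x * \<phi> x) \<le> norm (B * (indicator (cball 0 R) x *\<^sub>R \<phi> x))"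
      using f(2)[of x] \<phi>(2)[of x]
      by (cases "R < norm x") (auto simp: abs_mult indicator_def intro!: mult_right_mono)
  qed
qed

lemma continuous_compact_support_bounded:
  fixes \<phi> :: "'a::euclidean_space \<Rightarrow> real"
  assumes \<phi>: "continuous_on UNIV \<phi>" "\<And>x. R < norm x \<Longrightarrow> \<phi> x = 0"
  obtains C where "\<And>x. \<bar>\<phi> x\<bar> \<le> C"
proof -
  have "bounded (\<phi> ` cball 0 R)"
    using \<phi>(1) by (intro compact_imp_bounded compact_continuous_image) (auto intro: continuous_on_subset)
  then obtain C where C: "\<And>x. x \<in> cball 0 R \<Longrightarrow> \<bar>\<phi> x\<bar> \<le> C"
    unfolding bounded_iff by (metis imageI real_norm_def)
  have "\<bar>\<phi> x\<bar> \<le> max C 0" for x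
    using C[of x] \<phi>(2)[of x] by (cases "R < norm x") auto
  then show ?thesis using that by blast
qed

text \<open>Translation invariance moves the shift from the merely measurable factor to the
  continuous one.\<close>

lemma integral_shift_tendsto:
  fixes f \<phi> :: "'a::euclidean_space \<Rightarrow> real"
  assumes f: "f \<in> borel_measurable borel" "\<And>x. \<bar>f x\<bar> \<le> B"
    and \<phi>: "continuous_on UNIV \<phi>" "\<And>x. R < norm x \<Longrightarrow> \<phi> x = 0"
    and b: "norm b \<le> 1" and t: "t \<longlonglongrightarrow> 0" "\<And>k. \<bar>t k\<bar> \<le> 1"
  shows "(\<lambda>k. \<integral>x. f (x + t k *\<^sub>R b) * \<phi> x \<partial>lborel) \<longlonglongrightarrow> (\<integral>x. f x * \<phi> x \<partial>lborel)"
proof -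
  obtain C where C: "\<And>x. \<bar>\<phi> x\<bar> \<le> C" using continuous_compact_support_bounded[OF \<phi>] by blast
  have \<phi>c: "continuous_on UNIV (\<lambda>x. \<phi> (x - c))" for c
    by (rule continuous_on_compose2[OF \<phi>(1)]) (auto intro!: continuous_intros)
  note meas = borel_measurable_times[OF f(1) borel_measurable_continuous_onI[OF \<phi>c]]
  have "(\<integral>x. f (x + t k *\<^sub>R b) * \<phi> x \<partial>lborel) = (\<integral>x. f x * \<phi> (x - t k *\<^sub>R b) \<partial>lborel)" for k
    using integral_translation[OF meas, of "t k *\<^sub>R b" "t k *\<^sub>R b"] by simp
  moreover have "(\<lambda>k. \<integral>x. f x * \<phi> (x - t k *\<^sub>R b) \<partial>lborel) \<longlonglongrightarrow> (\<integral>x. f x * \<phi> x \<partial>lborel)"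
  proof (rule integral_dominated_convergence[where w = "\<lambda>x. indicator (cball 0 (R + 1)) x *\<^sub>R (B * C)"])
    show "integrable lborel (\<lambda>x. indicator (cball (0::'a) (R + 1)) x *\<^sub>R (B * C))"
      by (intro borel_integrable_compact) auto
    show "AE x in lborel. (\<lambda>k. f x * \<phi> (x - t k *\<^sub>R b)) \<longlonglongrightarrow> f x * \<phi> x"
    proof (rule AE_I2)
      fix x
      have "(\<lambda>k. x - t k *\<^sub>R b) \<longlonglongrightarrow> x - 0 *\<^sub>R b" by (intro tendsto_intros t(1))
      then have "(\<lambda>k. \<phi> (x - t k *\<^sub>R b)) \<longlonglongrightarrow> \<phi> x"
        using \<phi>(1) by (intro isCont_tendsto_compose[of x \<phi>]) (auto simp: continuous_on_eq_continuous_at)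
      then show "(\<lambda>k. f x * \<phi> (x - t k *\<^sub>R b)) \<longlonglongrightarrow> f x * \<phi> x" by (intro tendsto_intros)
    qed
    show "AE x in lborel. norm (f x * \<phi> (x - t k *\<^sub>R b)) \<le> indicator (cball 0 (R + 1)) x *\<^sub>R (B * C)" for k
    proof (rule AE_I2)
      fix x
      have B: "0 \<le> B" using f(2)[of x] by linarith
      show "norm (f x * \<phi> (x - t k *\<^sub>R b)) \<le> indicator (cball 0 (R + 1)) x *\<^sub>R (B * C)"
      proof (cases "norm x \<le> R + 1")
        case True
        then show ?thesis using f(2)[of x] C B by (auto simp: abs_mult intro!: mult_mono)
      next
        case False
        have "norm (t k *\<^sub>R b) \<le> 1" using mult_mono[OF t(2)[of k] b] by simp
        then have "R < norm (x - t k *\<^sub>R b)" using False norm_triangle_ineq2[of x "t k *\<^sub>R b"] by linarith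
        then show ?thesis using \<phi>(2) False by simp
      qed
    qed
  qed (use meas[of 0] meas in simp_all)
  ultimately show ?thesis by simp
qed

lemma nearest_height_bounded:
  fixes F :: "'a::euclidean_space set"
  assumes F: "compact F" "F \<noteq> {}"
  obtains B where "\<And>x. \<bar>nearest_height F e x\<bar> \<le> B"
proof -
  have "bounded ((\<lambda>y. y \<bullet> e) ` F)"
    using F(1) by (intro compact_imp_bounded compact_continuous_image continuous_intros)
  then obtain B where B: "\<And>y. y \<in> F \<Longrightarrow> \<bar>y \<bullet> e\<bar> \<le> B" by (auto simp: bounded_iff)
  have "\<bar>nearest_height F e x\<bar> \<le> B" for x
    using nearest_height_attained[OF F, of x e] B by (metis (mono_tags) mem_Collect_eq nearest_points_def)
  then show ?thesis using that by blast
qed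

text \<open>By monotonicity the largest height of the nearest points of \<open>x\<close> is at most the smallest height of
  those of \<open>x + t *\<^sub>R b\<close>. Integrated against a weight, the shift disappears as \<open>t\<close> tends to \<open>0\<close>, so
  the integral of the largest height is at most that of the smallest, and the two agree almost
  everywhere. This takes the place of a theorem on differentiability almost everywhere.\<close>

lemma AE_nearest_height_unique:
  fixes F :: "'a::euclidean_space set"
  assumes F: "compact F" "F \<noteq> {}" and b: "norm b \<le> 1"
  shows "AE x in lborel. nearest_height F b x = - nearest_height F (- b) x"
proof -
  define f g where "f = nearest_height F b" and "g x = - nearest_height F (- b) x" for x
  have f: "f \<in> borel_measurable borel" and g: "g \<in> borel_measurable borel"
    using nearest_height_measurable[OF F] unfolding f_def g_def by auto
  obtain B where fB: "\<And>x. \<bar>f x\<bar> \<le> B" using nearest_height_bounded[OF F] f_def by metis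
  obtain B' where gB: "\<And>x. \<bar>g x\<bar> \<le> B'" using nearest_height_bounded[OF F, of "- b"] g_def by auto
  have gf: "g x \<le> f x" for x
  proof -
    obtain y where "y \<in> nearest_points F x" "y \<bullet> (- b) = nearest_height F (- b) x"
      using nearest_height_attained[OF F] by metis
    moreover from this have "y \<bullet> b \<le> f x" using nearest_height_attained[OF F] f_def by metis
    ultimately show ?thesis by (simp add: g_def)
  qed
  have mono: "f x \<le> g (x + t *\<^sub>R b)" if "0 < t" for x t
  proof -
    obtain y where y: "y \<in> nearest_points F x" "y \<bullet> b = f x"
      using nearest_height_attained[OF F] f_def by metis
    obtain y' where y': "y' \<in> nearest_points F (x + t *\<^sub>R b)"
      "y' \<bullet> (- b) = nearest_height F (- b) (x + t *\<^sub>R b)"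
      using nearest_height_attained[OF F] by metis
    show ?thesis using nearest_points_monotone[OF y(1) y'(1) that] y(2) y'(2) by (simp add: g_def)
  qed
  have "AE x in lborel. norm x < real n \<longrightarrow> f x = g x" for n :: nat
  proof -
    define \<phi> :: "'a \<Rightarrow> real" where "\<phi> x = max 0 (real n - norm x)" for x
    have \<phi>: "continuous_on UNIV \<phi>" "\<And>x. real n < norm x \<Longrightarrow> \<phi> x = 0"
      unfolding \<phi>_def by (auto intro!: continuous_intros)
    have \<phi>0: "0 \<le> \<phi> x" for x by (simp add: \<phi>_def)
    note intf = integrable_bounded_mult_compact_support[OF f fB \<phi>]
    note intg = integrable_bounded_mult_compact_support[OF g gB \<phi>]
    define t where "t k = inverse (real (Suc k))" for k
    have t: "t \<longlonglongrightarrow> 0" "\<And>k. \<bar>t k\<bar> \<le> 1" "\<And>k. 0 < t k"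
      unfolding t_def using LIMSEQ_inverse_real_of_nat by (auto simp: divide_simps)
    have "(\<integral>x. f x * \<phi> x \<partial>lborel) \<le> (\<integral>x. g (x + t k *\<^sub>R b) * \<phi> x \<partial>lborel)" for k
    proof (rule integral_mono[OF intf])
      show "integrable lborel (\<lambda>x. g (x + t k *\<^sub>R b) * \<phi> x)"
        using gB g by (intro integrable_bounded_mult_compact_support[OF _ _ \<phi>]) auto
    qed (use mono t(3) \<phi>0 in \<open>auto intro!: mult_right_mono\<close>)
    then have "(\<integral>x. f x * \<phi> x \<partial>lborel) \<le> (\<integral>x. g x * \<phi> x \<partial>lborel)"
      using LIMSEQ_le_const[OF integral_shift_tendsto[OF g gB \<phi> b t(1,2)]] by blast
    then have "(\<integral>x. f x * \<phi> x - g x * \<phi> x \<partial>lborel) \<le> 0" using intf intg by simp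
    moreover have nn: "0 \<le> f x * \<phi> x - g x * \<phi> x" for x
      using gf \<phi>0 by (simp add: mult_right_mono)
    then have "0 \<le> (\<integral>x. f x * \<phi> x - g x * \<phi> x \<partial>lborel)" by simp
    ultimately have "(\<integral>x. f x * \<phi> x - g x * \<phi> x \<partial>lborel) = 0" by linarith
    then have "AE x in lborel. f x * \<phi> x - g x * \<phi> x = 0"
      using integral_nonneg_eq_0_iff_AE[OF Bochner_Integration.integrable_diff[OF intf intg]] nn by simp
    then show ?thesis
      by eventually_elim (auto simp: \<phi>_def)
  qed
  then have "AE x in lborel. \<forall>n::nat. norm x < real n \<longrightarrow> f x = g x"
    by (subst AE_all_countable) blast
  then show ?thesis
    by eventually_elim (use reals_Archimedean2 in \<open>auto simp: f_def g_def\<close>)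
qed

text \<open>Where a point \<open>x\<close> outside \<open>F\<close> has a unique nearest point \<open>y\<close>, this is the unit vector \<open>(x - y) / dist x y\<close>.
  Elsewhere each coordinate uses its own extremal nearest point, which keeps the function Borel
  measurable. On \<open>F\<close> itself the value is \<open>0\<close>, by division by zero.\<close>

definition infdist_gradient :: "'a::euclidean_space set \<Rightarrow> 'a \<Rightarrow> 'a" where
  "infdist_gradient F x = (\<Sum>b\<in>Basis. ((x \<bullet> b - nearest_height F b x) / infdist x F) *\<^sub>R b)"

lemma infdist_gradient_inner:
  "b \<in> Basis \<Longrightarrow> infdist_gradient F x \<bullet> b = (x \<bullet> b - nearest_height F b x) / infdist x F"
  by (simp add: infdist_gradient_def)

lemma infdist_gradient_measurable:
  fixes F :: "'a::euclidean_space set"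
  assumes "compact F" "F \<noteq> {}"
  shows "infdist_gradient F \<in> borel_measurable borel"
proof -
  note [measurable] = nearest_height_measurable[OF assms]
  have [measurable]: "(\<lambda>x. infdist x F) \<in> borel_measurable borel"
    by (intro borel_measurable_continuous_onI continuous_intros)
  show ?thesis unfolding infdist_gradient_def by measurable
qed

lemma infdist_gradient_component_le:
  fixes F :: "'a::euclidean_space set"
  assumes "compact F" "F \<noteq> {}" "b \<in> Basis"
  shows "\<bar>infdist_gradient F x \<bullet> b\<bar> \<le> 1"
proof -
  obtain y where y: "y \<in> nearest_points F x" "y \<bullet> b = nearest_height F b x"
    using nearest_height_attained[OF assms(1,2)] by metis
  then have "\<bar>x \<bullet> b - nearest_height F b x\<bar> \<le> infdist x F"
    using Basis_le_norm[OF assms(3), of "x - y"] by (simp add: nearest_points_def dist_norm inner_diff_left)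
  then show ?thesis
    using assms(3) by (cases "infdist x F = 0") (simp_all add: infdist_gradient_inner)
qed

lemma AE_norm_infdist_gradient_le:
  fixes F :: "'a::euclidean_space set"
  assumes F: "compact F" "F \<noteq> {}"
  shows "AE x in lborel. norm (infdist_gradient F x) \<le> 1"
proof -
  have "AE x in lborel. \<forall>b\<in>Basis. nearest_height F b x = - nearest_height F (- b) x"
    by (subst AE_ball_countable) (auto simp: countable_finite intro!: AE_nearest_height_unique[OF F])
  then show ?thesis
  proof eventually_elim
    case (elim x)
    obtain y where y: "y \<in> nearest_points F x" using nearest_height_attained[OF F] by metis
    have "y \<bullet> b = nearest_height F b x" if "b \<in> Basis" for b
    proof -
      have "y \<bullet> b \<le> nearest_height F b x" "y \<bullet> (- b) \<le> nearest_height F (- b) x"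
        using nearest_height_attained[OF F] y by metis+
      then show ?thesis using elim that by fastforce
    qed
    then have "infdist_gradient F x = (x - y) /\<^sub>R infdist x F"
      by (subst euclidean_eq_iff) (simp add: infdist_gradient_inner inner_diff_left divide_inverse mult.commute)
    moreover have "norm (x - y) = infdist x F" using y by (simp add: nearest_points_def dist_norm)
    ultimately show ?case
      using infdist_nonneg[of x F] by (cases "infdist x F = 0") (simp_all add: abs_of_nonneg)
  qed
qed

text \<open>The distance from \<open>x + h\<close> is at most the distance to the nearest point of \<open>x\<close>, and
  \<open>q - r \<le> (q\<^sup>2 - r\<^sup>2) / (2 r)\<close> replaces the norm by its square, which expands.\<close>

lemma infdist_increment_le:
  fixes F :: "'a::euclidean_space set"
  assumes y: "y \<in> nearest_points F x" and d: "0 < infdist x F"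
  shows "infdist (x + h) F - infdist x F \<le> (h \<bullet> (x - y)) / infdist x F + (norm h)\<^sup>2 / (2 * infdist x F)"
proof -
  let ?r = "infdist x F" and ?q = "norm (x + h - y)"
  have r: "?r\<^sup>2 = (norm (x - y))\<^sup>2" and yF: "y \<in> F" using y by (auto simp: nearest_points_def dist_norm)
  have "infdist (x + h) F \<le> ?q" using infdist_le[OF yF, of "x + h"] by (simp add: dist_norm)
  moreover have "?q - ?r \<le> (?q\<^sup>2 - ?r\<^sup>2) / (2 * ?r)"
  proof -
    have "(?q - ?r) * (2 * ?r) \<le> ?q\<^sup>2 - ?r\<^sup>2"
      using zero_le_power2[of "?q - ?r"] by (simp add: power2_eq_square algebra_simps)
    then show ?thesis using d by (simp add: pos_le_divide_eq)
  qed
  moreover have "?q\<^sup>2 - ?r\<^sup>2 = 2 * (h \<bullet> (x - y)) + (norm h)\<^sup>2"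
    unfolding r by (simp add: power2_norm_eq_inner algebra_simps inner_commute)
  then have "(?q\<^sup>2 - ?r\<^sup>2) / (2 * ?r) = (h \<bullet> (x - y)) / ?r + (norm h)\<^sup>2 / (2 * ?r)"
    using d by (simp add: field_simps)
  ultimately show ?thesis by linarith
qed

lemma infdist_increment_le_gradient:
  fixes F :: "'a::euclidean_space set"
  assumes F: "compact F" "F \<noteq> {}" and b: "b \<in> Basis" and d: "0 < infdist x F"
  shows "infdist (x + t *\<^sub>R b) F - infdist x F
    \<le> t * (infdist_gradient F x \<bullet> b) + t\<^sup>2 / (2 * infdist x F)"
proof -
  obtain y where y: "y \<in> nearest_points F x" "y \<bullet> b = nearest_height F b x"
    using nearest_height_attained[OF F] by metis
  show ?thesis
    using infdist_increment_le[OF y(1) d, of "t *\<^sub>R b"] b y(2)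
    by (simp add: infdist_gradient_inner inner_diff_right inner_commute[of b] right_diff_distrib)
qed


section \<open>The weak gradient of the distance function\<close>

lemma infdist_lipschitz: "\<bar>infdist x F - infdist y F\<bar> \<le> dist x y"
  using infdist_triangle[of x F y] infdist_triangle[of y F x] by (simp add: dist_commute)

text \<open>The one-sided estimate for the increment, used from \<open>x\<close> and, with the opposite step, from
  \<open>x + t *\<^sub>R b\<close>, encloses the difference quotient between values of the candidate gradient at these two
  points. Since \<open>infdist\<close> is 1-Lipschitz, the second point still has distance at least \<open>\<delta> / 2\<close>.\<close>

lemma infdist_difference_quotient_bounds:
  fixes F :: "'a::euclidean_space set"
  assumes F: "compact F" "F \<noteq> {}" and b: "b \<in> Basis"
    and d: "0 < \<delta>" "\<delta> \<le> infdist x F" and t: "0 < t" "t \<le> \<delta> / 2"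
  defines "DQ \<equiv> (infdist (x + t *\<^sub>R b) F - infdist x F) / t"
  shows "DQ \<le> infdist_gradient F x \<bullet> b + t / \<delta>"
    and "infdist_gradient F (x + t *\<^sub>R b) \<bullet> b - t / \<delta> \<le> DQ"
proof -
  let ?G = "\<lambda>x. infdist_gradient F x \<bullet> b" and ?x' = "x + t *\<^sub>R b"
  have d': "\<delta> / 2 \<le> infdist ?x' F"
    using infdist_lipschitz[of ?x' F x] d t b by (simp add: dist_norm)
  have "infdist ?x' F - infdist x F \<le> t * ?G x + t\<^sup>2 / (2 * infdist x F)"
    using infdist_increment_le_gradient[OF F b, of x t] d by linarith
  also have "t\<^sup>2 / (2 * infdist x F) \<le> t\<^sup>2 / \<delta>"
    using d by (intro divide_left_mono) auto
  finally have "infdist ?x' F - infdist x F \<le> t * (?G x + t / \<delta>)"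
    using d(1) by (simp add: power2_eq_square distrib_left)
  then show "DQ \<le> ?G x + t / \<delta>"
    using t(1) unfolding DQ_def by (simp add: pos_divide_le_eq mult.commute)
  have "infdist x F - infdist ?x' F \<le> - (t * ?G ?x') + t\<^sup>2 / (2 * infdist ?x' F)"
    using infdist_increment_le_gradient[OF F b, of ?x' "- t"] d(1) d' by simp
  also have "t\<^sup>2 / (2 * infdist ?x' F) \<le> t\<^sup>2 / \<delta>"
    using d(1) d' by (intro divide_left_mono) auto
  finally have "t * (?G ?x' - t / \<delta>) \<le> infdist ?x' F - infdist x F"
    using d(1) by (simp add: power2_eq_square right_diff_distrib)
  then show "?G ?x' - t / \<delta> \<le> DQ"
    using t(1) unfolding DQ_def by (simp add: pos_le_divide_eq mult.commute)
qed

lemma integrable_continuous_compact_support: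
  fixes \<phi> :: "'a::euclidean_space \<Rightarrow> real"
  assumes \<phi>: "continuous_on UNIV \<phi>" "\<And>x. R < norm x \<Longrightarrow> \<phi> x = 0"
  shows "integrable lborel \<phi>"
proof -
  have "integrable lborel (\<lambda>x. indicator (cball 0 R) x *\<^sub>R \<phi> x)"
    using \<phi>(1) by (intro borel_integrable_compact) (auto intro: continuous_on_subset)
  also have "(\<lambda>x. indicator (cball 0 R) x *\<^sub>R \<phi> x) = \<phi>"
    using \<phi>(2) by (auto simp: indicator_def fun_eq_iff not_le)
  finally show ?thesis .
qed

lemma test_function_support_radius:
  fixes \<Omega> :: "'a::euclidean_space set"
  assumes "\<phi> \<in> test_functions \<Omega>"
  obtains R where "\<And>x. R < norm x \<Longrightarrow> \<phi> x = 0"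
proof -
  obtain K where K: "compact K" "\<And>x. x \<notin> K \<Longrightarrow> \<phi> x = 0"
    using test_function_support[OF assms] by metis
  then obtain R where "\<And>x. x \<in> K \<Longrightarrow> norm x \<le> R"
    using compact_imp_bounded bounded_iff by metis
  then show ?thesis using that K(2) by (meson not_le)
qed

text \<open>A discrete integration by parts: translation moves the difference quotient from \<open>f\<close> to the test
  function, with reversed direction, where it converges by differentiability.\<close>

lemma integral_difference_quotient_tendsto:
  fixes f :: "'a::euclidean_space \<Rightarrow> real"
  assumes f: "continuous_on UNIV f" and \<phi>: "\<phi> \<in> test_functions \<Omega>"
    and b: "norm b \<le> 1" and t: "t \<longlonglongrightarrow> 0" "\<And>k. 0 < t k" "\<And>k. t k \<le> 1"
  shows "(\<lambda>k. \<integral>x. (f (x + t k *\<^sub>R b) - f x) / t k * \<phi> x \<partial>lborel)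
      \<longlonglongrightarrow> - (\<integral>x. f x * frechet_derivative \<phi> (at x) b \<partial>lborel)"
proof -
  obtain C where C: "0 \<le> C" "\<And>x y. \<bar>\<phi> x - \<phi> y\<bar> \<le> C * norm (x - y)"
    using test_function_derivative_bounded[OF \<phi>] by metis
  obtain R where R: "\<And>x. R < norm x \<Longrightarrow> \<phi> x = 0" using test_function_support_radius[OF \<phi>] by blast
  note \<phi>c = test_function_continuous[OF \<phi>, of UNIV]
  define q where "q k x = (\<phi> (x - t k *\<^sub>R b) - \<phi> x) / t k" for k x
  have norm_tb: "norm (t k *\<^sub>R b) \<le> 1" for k
    using mult_mono[OF t(3)[of k] b] t(2)[of k] by simp
  have shifted: "continuous_on UNIV (\<lambda>x. h (x + c))" if "continuous_on UNIV h"
    for h :: "'a \<Rightarrow> real" and c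
    by (rule continuous_on_compose2[OF that]) (auto intro!: continuous_intros)
  have qc: "continuous_on UNIV (q k)" for k
    using shifted[OF \<phi>c, of "- t k *\<^sub>R b"] t(2)[of k] \<phi>c unfolding q_def
    by (intro continuous_intros) (auto dest: less_imp_neq)
  have q0: "q k x = 0" if "R + 1 < norm x" for k x
  proof -
    have "R < norm (x - t k *\<^sub>R b)"
      using that norm_tb[of k] norm_triangle_ineq2[of x "t k *\<^sub>R b"] by linarith
    then show ?thesis using R that by (simp add: q_def)
  qed
  have qC: "\<bar>q k x\<bar> \<le> C" for k x
  proof -
    have "\<bar>\<phi> (x - t k *\<^sub>R b) - \<phi> x\<bar> \<le> C * norm (t k *\<^sub>R b)"
      using C(2)[of "x - t k *\<^sub>R b" x] by simp
    also have "\<dots> \<le> C * t k"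
      using mult_left_mono[OF b, of "t k"] t(2)[of k] C(1) by (intro mult_left_mono) auto
    finally show ?thesis using t(2)[of k] by (simp add: q_def pos_divide_le_eq)
  qed
  have q_lim: "(\<lambda>k. q k x) \<longlonglongrightarrow> - frechet_derivative \<phi> (at x) b" for x
  proof -
    have "((\<lambda>s. x - s *\<^sub>R b) has_derivative (\<lambda>h. - (h *\<^sub>R b))) (at 0)"
      by (auto intro!: derivative_eq_intros)
    from has_derivative_compose[OF this, of \<phi>] test_function_has_derivative[OF \<phi>, of x]
    have "((\<lambda>s. \<phi> (x - s *\<^sub>R b)) has_derivative
        (\<lambda>h. frechet_derivative \<phi> (at x) (- (h *\<^sub>R b)))) (at 0)" by simp
    moreover have "(\<lambda>h. frechet_derivative \<phi> (at x) (- (h *\<^sub>R b)))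
        = (*) (- frechet_derivative \<phi> (at x) b)"
      using has_derivative_linear[OF test_function_has_derivative[OF \<phi>], of x]
      by (simp add: fun_eq_iff linear_neg linear_cmul)
    ultimately have "((\<lambda>s. \<phi> (x - s *\<^sub>R b)) has_real_derivative - frechet_derivative \<phi> (at x) b) (at 0)"
      by (simp add: has_field_derivative_def)
    then have "((\<lambda>s. (\<phi> (x - s *\<^sub>R b) - \<phi> x) / s) \<longlongrightarrow> - frechet_derivative \<phi> (at x) b) (at 0)"
      by (simp add: has_field_derivative_iff)
    moreover have "t k \<noteq> 0" for k using t(2)[of k] by simp
    then have "filterlim t (at 0) sequentially"
      using t(1) by (auto simp: filterlim_at)
    ultimately show ?thesis unfolding q_def by (rule filterlim_compose)
  qed
  have fm: "f \<in> borel_measurable borel" using f by (rule borel_measurable_continuous_onI)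
  have "(\<integral>x. (f (x + t k *\<^sub>R b) - f x) / t k * \<phi> x \<partial>lborel) = (\<integral>x. f x * q k x \<partial>lborel)" for k
  proof -
    let ?a = "t k *\<^sub>R b"
    have i1: "integrable lborel (\<lambda>x. f (x + ?a) * \<phi> x)"
      using R by (intro integrable_continuous_compact_support[where R = R] continuous_intros shifted f \<phi>c) auto
    have i2: "integrable lborel (\<lambda>x. f x * \<phi> x)"
      using R by (intro integrable_continuous_compact_support[where R = R] continuous_intros f \<phi>c) auto
    have i3: "integrable lborel (\<lambda>x. f x * \<phi> (x - ?a))"
    proof (intro integrable_continuous_compact_support[where R = "R + 1"] continuous_intros f)
      show "continuous_on UNIV (\<lambda>x. \<phi> (x - ?a))" using shifted[OF \<phi>c, of "- ?a"] by simp
      show "f x * \<phi> (x - ?a) = 0" if "R + 1 < norm x" for x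
        using that norm_tb[of k] norm_triangle_ineq2[of x ?a] R[of "x - ?a"] by simp
    qed
    have "(\<integral>x. (f (x + ?a) - f x) / t k * \<phi> x \<partial>lborel)
        = ((\<integral>x. f (x + ?a) * \<phi> x \<partial>lborel) - (\<integral>x. f x * \<phi> x \<partial>lborel)) / t k"
      using i1 i2 by (simp add: left_diff_distrib flip: Bochner_Integration.integral_diff)
    also have "(\<integral>x. f (x + ?a) * \<phi> x \<partial>lborel) = (\<integral>x. f x * \<phi> (x - ?a) \<partial>lborel)"
      using integral_translation[OF borel_measurable_integrable[OF i3, simplified], of ?a] by simp
    also have "((\<integral>x. f x * \<phi> (x - ?a) \<partial>lborel) - (\<integral>x. f x * \<phi> x \<partial>lborel)) / t k
        = (\<integral>x. f x * q k x \<partial>lborel)"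
      using i2 i3 by (simp add: q_def right_diff_distrib flip: Bochner_Integration.integral_diff)
    finally show ?thesis .
  qed
  moreover have "(\<lambda>k. \<integral>x. f x * q k x \<partial>lborel)
      \<longlonglongrightarrow> (\<integral>x. f x * - frechet_derivative \<phi> (at x) b \<partial>lborel)"
  proof (rule integral_dominated_convergence[where w = "\<lambda>x. indicator (cball 0 (R + 1)) x *\<^sub>R (\<bar>f x\<bar> * C)"])
    show "integrable lborel (\<lambda>x. indicator (cball 0 (R + 1)) x *\<^sub>R (\<bar>f x\<bar> * C))"
      using f by (intro borel_integrable_compact continuous_intros) (auto intro: continuous_on_subset)
    show "(\<lambda>x. f x * q k x) \<in> borel_measurable lborel" for k
      using fm borel_measurable_continuous_onI[OF qc] by simp
    show "(\<lambda>x. f x * - frechet_derivative \<phi> (at x) b) \<in> borel_measurable lborel"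
      using fm borel_measurable_LIMSEQ_real[OF q_lim borel_measurable_continuous_onI[OF qc]]
      by (intro borel_measurable_times) simp_all
    show "AE x in lborel. (\<lambda>k. f x * q k x) \<longlonglongrightarrow> f x * - frechet_derivative \<phi> (at x) b"
      by (intro AE_I2 tendsto_intros q_lim)
    show "AE x in lborel. norm (f x * q k x) \<le> indicator (cball 0 (R + 1)) x *\<^sub>R (\<bar>f x\<bar> * C)" for k
    proof (rule AE_I2)
      fix x show "norm (f x * q k x) \<le> indicator (cball 0 (R + 1)) x *\<^sub>R (\<bar>f x\<bar> * C)"
        using q0[of x k] qC[of k x] by (cases "R + 1 < norm x") (auto simp: abs_mult intro: mult_left_mono)
    qed
  qed
  ultimately show ?thesis by simp
qed

text \<open>The difference quotients of the distance differ from the candidate gradient \<open>G\<close> by at most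
  \<open>G x - G (x + t *\<^sub>R b)\<close> plus a multiple of \<open>t\<close>. Tested against \<open>\<bar>\<phi>\<bar>\<close> this error vanishes in the limit because the
  shift does, although \<open>G\<close> need not be continuous.\<close>

lemma infdist_partial_integration:
  fixes F :: "'a::euclidean_space set"
  assumes F: "compact F" "F \<noteq> {}" and disj: "\<Omega> \<inter> F = {}"
    and \<phi>: "\<phi> \<in> test_functions \<Omega>" and b: "b \<in> Basis"
  shows "(\<integral>x. infdist x F * frechet_derivative \<phi> (at x) b \<partial>lborel)
      = - (\<integral>x. (infdist_gradient F x \<bullet> b) * \<phi> x \<partial>lborel)"
proof -
  obtain K where K: "compact K" "K \<subseteq> \<Omega>" "\<And>x. x \<notin> K \<Longrightarrow> \<phi> x = 0"
    using test_function_support[OF \<phi>] by metis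
  have "K \<inter> F = {}" using K(2) disj by blast
  then obtain \<delta> where \<delta>: "0 < \<delta>" "\<And>x y. x \<in> K \<Longrightarrow> y \<in> F \<Longrightarrow> \<delta> \<le> dist x y"
    using separate_compact_closed[OF K(1) compact_imp_closed[OF F(1)]] by metis
  have \<delta>_le: "\<delta> \<le> infdist x F" if "x \<in> K" for x
    using infdist_attains_inf[OF compact_imp_closed[OF F(1)] F(2), of x] \<delta>(2)[OF that] by metis
  obtain R where R: "\<And>x. R < norm x \<Longrightarrow> \<phi> x = 0" using test_function_support_radius[OF \<phi>] by blast
  note \<phi>c = test_function_continuous[OF \<phi>, of UNIV]
  have \<phi>abs: "continuous_on UNIV (\<lambda>x. \<bar>\<phi> x\<bar>)" "\<And>x. R < norm x \<Longrightarrow> \<bar>\<phi> x\<bar> = 0"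
    using \<phi>c R by (auto intro!: continuous_intros)
  define G where "G x = infdist_gradient F x \<bullet> b" for x
  have Gm: "G \<in> borel_measurable borel"
    unfolding G_def using infdist_gradient_measurable[OF F] by simp
  have G1: "\<bar>G x\<bar> \<le> 1" for x unfolding G_def by (rule infdist_gradient_component_le[OF F b])
  \<comment> \<open>Steps at most \<open>\<delta> / 2\<close> keep the shifted support of \<open>\<phi>\<close> away from \<open>F\<close>.\<close>
  define t where "t k = min 1 (\<delta> / 2) * inverse (real (Suc k))" for k
  have t: "0 < t k" "t k \<le> 1" "t k \<le> \<delta> / 2" for k
  proof -
    have i: "0 < inverse (real (Suc k))" "inverse (real (Suc k)) \<le> 1" by (auto simp: divide_simps)
    have m: "0 < min 1 (\<delta> / 2)" using \<delta>(1) by simp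
    show "0 < t k" unfolding t_def using i m by simp
    have "t k \<le> min 1 (\<delta> / 2)" unfolding t_def using mult_left_mono[OF i(2), of "min 1 (\<delta> / 2)"] m by simp
    then show "t k \<le> 1" "t k \<le> \<delta> / 2" by auto
  qed
  have "t \<longlonglongrightarrow> min 1 (\<delta> / 2) * 0"
    unfolding t_def by (intro tendsto_intros LIMSEQ_inverse_real_of_nat)
  then have t0: "t \<longlonglongrightarrow> 0" by simp
  define DQ where "DQ k x = (infdist (x + t k *\<^sub>R b) F - infdist x F) / t k" for k x
  have DQm: "DQ k \<in> borel_measurable borel" for k
    unfolding DQ_def using t(1)[of k] by (intro borel_measurable_continuous_onI continuous_intros) auto
  have DQ1: "\<bar>DQ k x\<bar> \<le> 1" for k x
    using infdist_lipschitz[of "x + t k *\<^sub>R b" F x] t(1)[of k] b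
    by (simp add: DQ_def dist_norm pos_divide_le_eq)
  have DQ: "(\<lambda>k. \<integral>x. DQ k x * \<phi> x \<partial>lborel)
      \<longlonglongrightarrow> - (\<integral>x. infdist x F * frechet_derivative \<phi> (at x) b \<partial>lborel)"
    unfolding DQ_def using t0 t(1,2) b
    by (intro integral_difference_quotient_tendsto[OF _ \<phi>] continuous_intros) auto
  have Gs: "(\<lambda>x. G (x + t k *\<^sub>R b)) \<in> borel_measurable borel" for k using Gm by simp
  note iG = integrable_bounded_mult_compact_support[OF Gm G1]
  note iGs = integrable_bounded_mult_compact_support[OF Gs G1]
  have i1: "integrable lborel (\<lambda>x. \<bar>\<phi> x\<bar>)"
    by (rule integrable_continuous_compact_support[OF \<phi>abs])
  let ?E = "\<lambda>k. (\<integral>x. G x * \<bar>\<phi> x\<bar> \<partial>lborel) - (\<integral>x. G (x + t k *\<^sub>R b) * \<bar>\<phi> x\<bar> \<partial>lborel)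
      + 3 * t k / \<delta> * (\<integral>x. \<bar>\<phi> x\<bar> \<partial>lborel)"
  have err: "\<bar>(\<integral>x. DQ k x * \<phi> x \<partial>lborel) - (\<integral>x. G x * \<phi> x \<partial>lborel)\<bar> \<le> ?E k" for k
  proof -
    note iDQ = integrable_bounded_mult_compact_support[OF DQm DQ1 \<phi>c R]
    have "(\<integral>x. DQ k x * \<phi> x \<partial>lborel) - (\<integral>x. G x * \<phi> x \<partial>lborel)
        = (\<integral>x. DQ k x * \<phi> x - G x * \<phi> x \<partial>lborel)"
      using iDQ iG[OF \<phi>c R] by simp
    also have "\<bar>\<dots>\<bar> \<le> (\<integral>x. G x * \<bar>\<phi> x\<bar> - G (x + t k *\<^sub>R b) * \<bar>\<phi> x\<bar> + 3 * t k / \<delta> * \<bar>\<phi> x\<bar> \<partial>lborel)"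
    proof (rule order_trans[OF integral_abs_bound integral_mono])
      fix x
      show "\<bar>DQ k x * \<phi> x - G x * \<phi> x\<bar>
          \<le> G x * \<bar>\<phi> x\<bar> - G (x + t k *\<^sub>R b) * \<bar>\<phi> x\<bar> + 3 * t k / \<delta> * \<bar>\<phi> x\<bar>"
      proof (cases "\<phi> x = 0")
        case False
        then have "\<delta> \<le> infdist x F" using K(3) \<delta>_le by blast
        note bounds = infdist_difference_quotient_bounds[OF F b \<delta>(1) this t(1,3), of k]
        have "\<bar>DQ k x - G x\<bar> \<le> G x - G (x + t k *\<^sub>R b) + 3 * (t k / \<delta>)"
        proof -
          have "0 < t k / \<delta>" using t(1)[of k] \<delta>(1) by simp
          with bounds show ?thesis unfolding DQ_def G_def by linarith
        qed
        from mult_right_mono[OF this abs_ge_zero[of "\<phi> x"]] show ?thesis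
          by (simp add: abs_mult[symmetric] algebra_simps)
      qed simp
    qed (use iDQ iG[OF \<phi>c R] iG[OF \<phi>abs] iGs[OF \<phi>abs] i1 in auto)
    also have "\<dots> = ?E k" using iG[OF \<phi>abs] iGs[OF \<phi>abs] i1 by simp
    finally show ?thesis .
  qed
  have "?E \<longlonglongrightarrow> (\<integral>x. G x * \<bar>\<phi> x\<bar> \<partial>lborel) - (\<integral>x. G x * \<bar>\<phi> x\<bar> \<partial>lborel)
      + 3 * 0 / \<delta> * (\<integral>x. \<bar>\<phi> x\<bar> \<partial>lborel)"
    using \<delta>(1) t(1,2) b
    by (intro tendsto_intros t0 integral_shift_tendsto[OF Gm G1 \<phi>abs]) (auto simp: abs_of_pos)
  then have "?E \<longlonglongrightarrow> 0" by simp
  then have "(\<lambda>k. (\<integral>x. DQ k x * \<phi> x \<partial>lborel) - (\<integral>x. G x * \<phi> x \<partial>lborel)) \<longlonglongrightarrow> 0"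
    by (rule Lim_null_comparison[rotated]) (use err in \<open>auto intro!: always_eventually\<close>)
  then have "(\<lambda>k. \<integral>x. DQ k x * \<phi> x \<partial>lborel) \<longlonglongrightarrow> (\<integral>x. G x * \<phi> x \<partial>lborel)"
    by (simp add: LIM_zero_iff)
  from LIMSEQ_unique[OF this DQ] show ?thesis by (simp add: G_def)
qed


section \<open>Essential suprema and the chosen weak gradient\<close>

lemma AE_le_Linf_norm:
  assumes "g \<in> Linf \<Omega>"
  shows "AE x in lebesgue_on \<Omega>. norm (g x) \<le> Linf_norm \<Omega> g"
  using esssup_AE[of "\<lambda>x. ereal (norm (g x))" "lebesgue_on \<Omega>"]
proof eventually_elim
  case (elim x)
  let ?s = "esssup (lebesgue_on \<Omega>) (\<lambda>x. ereal (norm (g x)))"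
  have "?s < \<infinity>" using assms by (simp add: Linf_def)
  \<comment> \<open>The value \<open>-\<infinity>\<close>, which \<open>real_of_ereal\<close> sends to \<open>0\<close>,
    would contradict nonnegativity of the norm.\<close>
  with elim show ?case by (cases ?s) (auto simp: Linf_norm_def)
qed

lemma Linf_I:
  assumes "g \<in> borel_measurable (lebesgue_on \<Omega>)" "AE x in lebesgue_on \<Omega>. norm (g x) \<le> c"
  shows "g \<in> Linf \<Omega>"
proof -
  have "esssup (lebesgue_on \<Omega>) (\<lambda>x. ereal (norm (g x))) \<le> ereal c"
    using assms by (intro esssup_I) auto
  also have "\<dots> < \<infinity>" by simp
  finally show ?thesis using assms(1) by (simp add: Linf_def)
qed

lemma Linf_norm_le:
  assumes "g \<in> borel_measurable (lebesgue_on \<Omega>)" "AE x in lebesgue_on \<Omega>. norm (g x) \<le> c" "0 \<le> c"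
  shows "Linf_norm \<Omega> g \<le> c"
proof -
  let ?s = "esssup (lebesgue_on \<Omega>) (\<lambda>x. ereal (norm (g x)))"
  have "?s \<le> ereal c" using assms(1,2) by (intro esssup_I) auto
  then show ?thesis using assms(3) by (cases ?s) (auto simp: Linf_norm_def)
qed

lemma borel_measurable_lebesgue_on_AE:
  fixes f g :: "'a::euclidean_space \<Rightarrow> 'b::euclidean_space"
  assumes S: "S \<in> sets lebesgue" and f: "f \<in> borel_measurable (lebesgue_on S)"
    and ae: "AE x in lebesgue_on S. f x = g x"
  shows "g \<in> borel_measurable (lebesgue_on S)"
proof -
  have "AE x in lebesgue. (if x \<in> S then f x else 0) = (if x \<in> S then g x else 0)"
    using ae S by (simp add: AE_restrict_space_iff)
  from borel_measurable_AE[OF _ this] show ?thesis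
    using f by (simp add: borel_measurable_if[OF S])
qed

text \<open>\<open>Linf_norm\<close> is meaningful only for measurable functions with finite essential supremum;
  uniqueness and completeness of Lebesgue measure transfer both properties to the chosen gradient.\<close>

lemma weak_gradient_AE_eq:
  fixes \<Omega> :: "'a::euclidean_space set"
  assumes \<Omega>: "open \<Omega>" and g: "has_weak_gradient \<Omega> u g" "g \<in> Linf \<Omega>"
  shows "has_weak_gradient \<Omega> u (weak_gradient \<Omega> u)"
    and "AE x in lebesgue_on \<Omega>. g x = weak_gradient \<Omega> u x"
    and "weak_gradient \<Omega> u \<in> Linf \<Omega>"
proof -
  show 1: "has_weak_gradient \<Omega> u (weak_gradient \<Omega> u)"
    unfolding weak_gradient_def by (rule someI[where P = "has_weak_gradient \<Omega> u", OF g(1)])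
  show 2: "AE x in lebesgue_on \<Omega>. g x = weak_gradient \<Omega> u x"
    by (rule weak_gradient_unique[OF \<Omega> g(1) 1])
  show "weak_gradient \<Omega> u \<in> Linf \<Omega>"
  proof (rule Linf_I)
    show "weak_gradient \<Omega> u \<in> borel_measurable (lebesgue_on \<Omega>)"
      using g(2) \<Omega> by (intro borel_measurable_lebesgue_on_AE[OF _ _ 2]) (auto simp: Linf_def)
    show "AE x in lebesgue_on \<Omega>. norm (weak_gradient \<Omega> u x) \<le> Linf_norm \<Omega> g"
      using AE_le_Linf_norm[OF g(2)] 2 by eventually_elim simp
  qed
qed

section \<open>The distance to the boundary as a competitor\<close>

lemma locally_integrable_continuous:
  fixes f :: "'a::euclidean_space \<Rightarrow> real"
  assumes "continuous_on UNIV f" shows "locally_integrable \<Omega> f"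
  unfolding locally_integrable_def set_integrable_def
proof (intro allI impI)
  fix K assume K: "compact K \<and> K \<subseteq> \<Omega>"
  have c: "continuous_on K f" using assms by (rule continuous_on_subset) simp
  have "integrable lborel (\<lambda>x. indicator K x *\<^sub>R f x)"
    using K c by (intro borel_integrable_compact) auto
  then show "integrable lebesgue (\<lambda>x. indicator K x *\<^sub>R f x)"
    using borel_measurable_integrable by (subst integrable_completion) auto
qed

lemma locally_integrable_bounded:
  fixes g :: "'a::euclidean_space \<Rightarrow> 'b::euclidean_space"
  assumes g: "g \<in> borel_measurable borel" "\<And>x. norm (g x) \<le> B" shows "locally_integrable \<Omega> g"
  unfolding locally_integrable_def set_integrable_def
proof (intro allI impI)
  fix K assume K: "compact K \<and> K \<subseteq> \<Omega>"
  have Km: "K \<in> sets borel" using K by (auto intro: borel_compact)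
  have "integrable lborel (\<lambda>x. indicator K x *\<^sub>R g x)"
  proof (rule Bochner_Integration.integrable_bound)
    show "integrable lborel (\<lambda>x. indicator K x *\<^sub>R B)"
      using K by (intro borel_integrable_compact) auto
    show "(\<lambda>x. indicator K x *\<^sub>R g x) \<in> borel_measurable lborel"
      using Km g(1) by simp
    show "AE x in lborel. norm (indicator K x *\<^sub>R g x) \<le> norm (indicator K x *\<^sub>R B)"
    proof (rule AE_I2)
      fix x show "norm (indicator K x *\<^sub>R g x) \<le> norm (indicator K x *\<^sub>R B)"
        using g(2)[of x] by (auto simp: indicator_def)
    qed
  qed
  then show "integrable lebesgue (\<lambda>x. indicator K x *\<^sub>R g x)"
    using borel_measurable_integrable by (subst integrable_completion) auto
qed

lemma infdist_continuous: "continuous_on S (\<lambda>x. infdist x F)"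
  by (intro continuous_intros)

lemma infdist_has_weak_gradient:
  fixes F :: "'a::euclidean_space set"
  assumes F: "compact F" "F \<noteq> {}" and \<Omega>: "open \<Omega>" "\<Omega> \<inter> F = {}"
  shows "has_weak_gradient \<Omega> (\<lambda>x. infdist x F) (infdist_gradient F)"
  unfolding has_weak_gradient_def
proof (intro conjI ballI)
  note Gm = infdist_gradient_measurable[OF F]
  show "locally_integrable \<Omega> (\<lambda>x. infdist x F)"
    by (rule locally_integrable_continuous[OF infdist_continuous])
  show "locally_integrable \<Omega> (infdist_gradient F)"
  proof (rule locally_integrable_bounded[OF Gm])
    fix x
    have "norm (infdist_gradient F x) \<le> (\<Sum>b\<in>Basis. \<bar>infdist_gradient F x \<bullet> b\<bar>)" by (rule norm_le_l1)
    also have "\<dots> \<le> (\<Sum>b\<in>(Basis::'a set). 1)"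
      by (intro sum_mono infdist_gradient_component_le[OF F])
    finally show "norm (infdist_gradient F x) \<le> (\<Sum>b\<in>(Basis::'a set). 1)" .
  qed
  fix \<phi> b assume \<phi>: "\<phi> \<in> test_functions \<Omega>" and b: "b \<in> (Basis::'a set)"
  have dm: "(\<lambda>x. infdist x F) \<in> borel_measurable borel"
    by (rule borel_measurable_continuous_onI[OF infdist_continuous])
  have Gbm: "(\<lambda>x. infdist_gradient F x \<bullet> b) \<in> borel_measurable borel" using Gm by simp
  show "(\<integral>x. infdist x F * frechet_derivative \<phi> (at x) b \<partial>lebesgue_on \<Omega>)
      = - (\<integral>x. (infdist_gradient F x \<bullet> b) * \<phi> x \<partial>lebesgue_on \<Omega>)"
    using infdist_partial_integration[OF F \<Omega>(2) \<phi> b]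
    by (simp only: integral_mult_test_function_lborel[OF \<Omega>(1) dm test_function_partial[OF \<phi> b]]
        integral_mult_test_function_lborel[OF \<Omega>(1) Gbm \<phi>])
qed

lemma infdist_frontier_pos:
  fixes \<Omega> :: "'a::euclidean_space set"
  assumes "open \<Omega>" "frontier \<Omega> \<noteq> {}" "x \<in> \<Omega>" shows "0 < infdist x (frontier \<Omega>)"
proof -
  have "x \<notin> frontier \<Omega>" using assms(1,3) by (simp add: frontier_def interior_open)
  then show ?thesis
    using assms(2) in_closed_iff_infdist_zero[OF frontier_closed, of \<Omega> x] infdist_nonneg[of x "frontier \<Omega>"]
    by linarith
qed

lemma AE_lebesgue_on_open_imp_ex:
  fixes \<Omega> :: "'a::euclidean_space set"
  assumes "open \<Omega>" "\<Omega> \<noteq> {}" "AE x in lebesgue_on \<Omega>. P x"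
  shows "\<exists>x\<in>\<Omega>. P x"
proof -
  have "AE x in lebesgue. x \<in> \<Omega> \<longrightarrow> P x"
    using assms by (simp add: AE_restrict_space_iff)
  then obtain N where "negligible N" "{x. \<not> (x \<in> \<Omega> \<longrightarrow> P x)} \<subseteq> N"
    unfolding eventually_ae_filter_negligible by blast
  moreover have "\<not> \<Omega> \<subseteq> N"
    using open_not_negligible[OF assms(1,2)] \<open>negligible N\<close> negligible_subset by blast
  ultimately show ?thesis by blast
qed

lemma integrable_continuous_on_closure:
  fixes v :: "'a::euclidean_space \<Rightarrow> real"
  assumes \<Omega>: "open \<Omega>" "bounded \<Omega>" and v: "continuous_on (closure \<Omega>) v"
  shows "integrable (lebesgue_on \<Omega>) v"
proof -
  interpret finite_measure "lebesgue_on \<Omega>" using bounded_open_finite_measure[OF \<Omega>] .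
  have "bounded (v ` closure \<Omega>)"
    using v \<Omega>(2) by (intro compact_imp_bounded compact_continuous_image) auto
  then obtain B where B: "\<And>x. x \<in> closure \<Omega> \<Longrightarrow> \<bar>v x\<bar> \<le> B"
    unfolding bounded_iff by (metis imageI real_norm_def)
  show ?thesis
  proof (rule integrable_const_bound[where B = B])
    show "AE x in lebesgue_on \<Omega>. norm (v x) \<le> B"
      using B closure_subset[of \<Omega>] by (intro AE_I2) auto
    show "v \<in> borel_measurable (lebesgue_on \<Omega>)"
      using \<Omega> v closure_subset
      by (intro continuous_imp_measurable_on_sets_lebesgue) (auto intro: continuous_on_subset)
  qed
qed

lemma infdist_frontier_admissible:
  fixes \<Omega> :: "'a::euclidean_space set"
  assumes \<Omega>: "open \<Omega>" "bounded \<Omega>" "\<Omega> \<noteq> {}"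
  defines "d \<equiv> \<lambda>x. infdist x (frontier \<Omega>)"
  shows "d \<in> W1inf0_nonzero \<Omega>" and "Linf_norm \<Omega> (weak_gradient \<Omega> d) \<le> 1"
proof -
  let ?F = "frontier \<Omega>"
  have "\<Omega> \<noteq> UNIV" using \<Omega>(2) not_bounded_UNIV by auto
  then have F: "compact ?F" "?F \<noteq> {}"
    using \<Omega> frontier_not_empty[of \<Omega>] by (auto simp: compact_frontier_bounded)
  have disj: "\<Omega> \<inter> ?F = {}" using \<Omega>(1) by (auto simp: frontier_def interior_open)
  have wg: "has_weak_gradient \<Omega> d (infdist_gradient ?F)"
    unfolding d_def by (rule infdist_has_weak_gradient[OF F \<Omega>(1) disj])
  have AE1: "AE x in lebesgue_on \<Omega>. norm (infdist_gradient ?F x) \<le> 1"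
    using AE_completion[OF AE_norm_infdist_gradient_le[OF F]] \<Omega>(1)
    by (simp add: AE_restrict_space_iff) (auto elim: eventually_mono)
  have gL: "infdist_gradient ?F \<in> Linf \<Omega>"
    using infdist_gradient_measurable[OF F]
    by (intro Linf_I[OF _ AE1] measurable_restrict_space1 measurable_completion) simp
  note wg' = weak_gradient_AE_eq[OF \<Omega>(1) wg gL]
  have "AE x in lebesgue_on \<Omega>. norm (weak_gradient \<Omega> d x) \<le> 1"
    using AE1 wg'(2) by eventually_elim simp
  then show "Linf_norm \<Omega> (weak_gradient \<Omega> d) \<le> 1"
    using wg'(3) by (intro Linf_norm_le) (auto simp: Linf_def)
  have dc: "continuous_on (closure \<Omega>) d" unfolding d_def by (rule infdist_continuous)
  have "bounded (d ` closure \<Omega>)"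
    using dc \<Omega>(2) by (intro compact_imp_bounded compact_continuous_image) auto
  then obtain B where B: "\<And>x. x \<in> closure \<Omega> \<Longrightarrow> \<bar>d x\<bar> \<le> B"
    unfolding bounded_iff by (metis imageI real_norm_def)
  have "d \<in> Linf \<Omega>"
  proof (rule Linf_I)
    show "d \<in> borel_measurable (lebesgue_on \<Omega>)"
      using integrable_continuous_on_closure[OF \<Omega>(1,2) dc] by (rule borel_measurable_integrable)
    show "AE x in lebesgue_on \<Omega>. norm (d x) \<le> B"
      using B closure_subset[of \<Omega>] by (intro AE_I2) auto
  qed
  then have "d \<in> W1inf \<Omega>" using wg gL by (auto simp: W1inf_def)
  moreover have "d x = 0" if "x \<in> ?F" for x using that by (simp add: d_def)
  ultimately have "d \<in> W1inf0 \<Omega>" using dc unfolding W1inf0_def by auto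
  moreover have "\<not> (AE x in lebesgue_on \<Omega>. d x = 0)"
  proof
    assume "AE x in lebesgue_on \<Omega>. d x = 0"
    then obtain x where "x \<in> \<Omega>" "d x = 0" using AE_lebesgue_on_open_imp_ex[OF \<Omega>(1,3)] by blast
    then show False using infdist_frontier_pos[OF \<Omega>(1) F(2), of x] unfolding d_def by simp
  qed
  ultimately show "d \<in> W1inf0_nonzero \<Omega>" by (simp add: W1inf0_nonzero_def)
qed

section \<open>Minimisers of the quotient\<close>

text \<open>A ball that meets both \<open>\<Omega>\<close> and its complement meets the frontier, by connectedness.\<close>

lemma ball_infdist_frontier_subset:
  fixes \<Omega> :: "'a::euclidean_space set"
  assumes "x \<in> \<Omega>" shows "ball x (infdist x (frontier \<Omega>)) \<subseteq> \<Omega>"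
proof (rule ccontr)
  assume "\<not> ?thesis"
  then have out: "ball x (infdist x (frontier \<Omega>)) - \<Omega> \<noteq> {}" by blast
  then have "0 < infdist x (frontier \<Omega>)" by (metis Diff_empty ball_empty empty_Diff not_le)
  then have "ball x (infdist x (frontier \<Omega>)) \<inter> \<Omega> \<noteq> {}" using assms centre_in_ball by blast
  then obtain y where "y \<in> ball x (infdist x (frontier \<Omega>))" "y \<in> frontier \<Omega>"
    using connected_Int_frontier[OF connected_ball _ out] by blast
  then show False using infdist_le[of y "frontier \<Omega>" x] by simp
qed

text \<open>The segment from \<open>x\<close> to a nearest boundary point \<open>y\<close> stays in the ball around \<open>x\<close> of radius
  \<open>infdist x (frontier \<Omega>)\<close>, hence in \<open>\<Omega>\<close>, except for \<open>y\<close> itself. The Lipschitz bound along the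
  segment extends to its endpoint by continuity, and \<open>v y = 0\<close>.\<close>

lemma le_gradient_bound_times_infdist:
  fixes \<Omega> :: "'a::euclidean_space set"
  assumes \<Omega>: "open \<Omega>" "bounded \<Omega>" "\<Omega> \<noteq> {}" and u: "u \<in> borel_measurable (lebesgue_on \<Omega>)"
    and B: "AE x in lebesgue_on \<Omega>. \<bar>u x\<bar> \<le> B" and g: "has_weak_gradient \<Omega> u g"
    and L: "AE x in lebesgue_on \<Omega>. norm (g x) \<le> L" "0 \<le> L"
    and v: "continuous_on (closure \<Omega>) v" "AE x in lebesgue_on \<Omega>. v x = u x"
      "\<And>x. x \<in> frontier \<Omega> \<Longrightarrow> v x = 0"
    and x: "x \<in> \<Omega>"
  shows "\<bar>v x\<bar> \<le> L * infdist x (frontier \<Omega>)"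
proof -
  have "\<Omega> \<noteq> UNIV" using \<Omega>(2) not_bounded_UNIV by auto
  then have "frontier \<Omega> \<noteq> {}" using \<Omega>(3) frontier_not_empty[of \<Omega>] by auto
  then obtain y where y: "y \<in> frontier \<Omega>" "infdist x (frontier \<Omega>) = dist x y"
    using infdist_attains_inf[OF frontier_closed] by metis
  define s where "s k = 1 - inverse (real (Suc k))" for k
  define p where "p k = x + s k *\<^sub>R (y - x)" for k
  have s: "0 \<le> s k" "s k < 1" for k by (auto simp: s_def divide_simps)
  have "x \<notin> frontier \<Omega>" using \<Omega>(1) x by (simp add: frontier_def interior_open)
  then have xy: "0 < norm (y - x)" using y(1) by auto
  have in_ball: "z \<in> \<Omega>" if "norm (z - x) < norm (y - x)" for z
    using ball_infdist_frontier_subset[OF x] that y(2) by (auto simp: dist_norm norm_minus_commute)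
  have norm_p: "norm (p k - x) = s k * norm (y - x)" for k using s(1)[of k] by (simp add: p_def)
  have bound: "\<bar>v x\<bar> \<le> L * norm (y - x) + \<bar>v (p k)\<bar>" for k
  proof -
    have "closed_segment x (p k) \<subseteq> \<Omega>"
    proof
      fix z assume "z \<in> closed_segment x (p k)"
      then have "norm (z - x) \<le> norm (p k - x)" by (rule segment_bound)
      also have "\<dots> < norm (y - x)" unfolding norm_p using s(2)[of k] xy by simp
      finally show "z \<in> \<Omega>" by (rule in_ball)
    qed
    moreover have "continuous_on \<Omega> v" using v(1) closure_subset by (rule continuous_on_subset)
    ultimately have "\<bar>v (p k) - v x\<bar> \<le> L * norm (p k - x)"
      by (intro essentially_lipschitz_on_segment[OF \<Omega>(1,2) u B g L(1) _ v(2)])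
    also have "\<dots> \<le> L * norm (y - x)"
      unfolding norm_p using s[of k] by (intro mult_left_mono L(2)) (simp add: mult_left_le_one_le)
    finally show ?thesis by linarith
  qed
  have "s \<longlonglongrightarrow> 1 - 0" unfolding s_def by (intro tendsto_intros LIMSEQ_inverse_real_of_nat)
  then have "p \<longlonglongrightarrow> x + (1 - 0) *\<^sub>R (y - x)" unfolding p_def by (intro tendsto_intros)
  then have p_lim: "p \<longlonglongrightarrow> y" by simp
  have "p k \<in> closure \<Omega>" for k
  proof -
    have "norm (p k - x) < norm (y - x)" unfolding norm_p using s(2)[of k] xy by simp
    then show ?thesis using in_ball closure_subset by blast
  qed
  then have "(\<lambda>k. v (p k)) \<longlonglongrightarrow> v y"
    using y(1) p_lim v(1) by (intro continuous_on_tendsto_compose[OF v(1)]) (auto simp: frontier_def)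
  then have "(\<lambda>k. L * norm (y - x) + \<bar>v (p k)\<bar>) \<longlonglongrightarrow> L * norm (y - x) + \<bar>v y\<bar>"
    by (intro tendsto_intros)
  then have "\<bar>v x\<bar> \<le> L * norm (y - x) + \<bar>v y\<bar>"
    using bound by (intro LIMSEQ_le_const) auto
  then show ?thesis using v(3)[OF y(1)] y(2) by (simp add: dist_norm norm_minus_commute)
qed

text \<open>The set where two continuous functions differ is open, and a nonempty open set is not
  negligible.\<close>

lemma continuous_AE_eq_imp_eq:
  fixes f g :: "'a::euclidean_space \<Rightarrow> real"
  assumes \<Omega>: "open \<Omega>" and c: "continuous_on \<Omega> f" "continuous_on \<Omega> g"
    and ae: "AE x in lebesgue_on \<Omega>. f x = g x" and x: "x \<in> \<Omega>"
  shows "f x = g x"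
proof (rule ccontr)
  assume neq: "f x \<noteq> g x"
  let ?U = "{x \<in> \<Omega>. f x - g x \<in> - {0}}"
  have U: "open ?U"
    using continuous_open_preimage[OF continuous_on_diff[OF c] \<Omega>, of "- {0}"]
    by (simp add: vimage_def Int_def conj_commute open_Compl)
  have "AE x in lebesgue. x \<in> ?U \<longrightarrow> f x = g x"
    using ae \<Omega> by (simp add: AE_restrict_space_iff)
  then have "AE x in lebesgue_on ?U. f x = g x" using U by (simp add: AE_restrict_space_iff)
  moreover have "?U \<noteq> {}" using neq x by auto
  ultimately obtain z where "z \<in> ?U" "f z = g z"
    using AE_lebesgue_on_open_imp_ex[OF U] by blast
  then show False by simp
qed

theorem theorem2p80:
  fixes \<Omega> :: "(real ^ 'n) set" and u :: "real ^ 'n \<Rightarrow> real"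
  assumes "open \<Omega>" and "bounded \<Omega>" and "connected \<Omega>" and "\<Omega> \<noteq> {}"
    and "piecewise_smooth_boundary \<Omega>"
    and "is_arg_min (rayleigh_quotient \<Omega>) (\<lambda>v. v \<in> W1inf0_nonzero \<Omega>) u"
  shows "\<exists>c::real. AE x in lebesgue_on \<Omega>. u x = c * infdist x (frontier \<Omega>)"
proof -
  note \<Omega> = assms(1,2,4)
  define d where "d x = infdist x (frontier \<Omega>)" for x
  let ?M = "lebesgue_on \<Omega>"
  have d: "d \<in> W1inf0_nonzero \<Omega>" "Linf_norm \<Omega> (weak_gradient \<Omega> d) \<le> 1"
    using infdist_frontier_admissible[OF \<Omega>] by (simp_all add: d_def[abs_def])
  have dc: "continuous_on S d" for S unfolding d_def by (rule infdist_continuous)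
  have u: "u \<in> W1inf0_nonzero \<Omega>" using assms(6) by (simp add: is_arg_min_def)
  have min: "rayleigh_quotient \<Omega> u \<le> rayleigh_quotient \<Omega> d"
    using assms(6) d(1) by (auto simp: is_arg_min_def not_less)
  obtain v where v: "continuous_on (closure \<Omega>) v" "AE x in ?M. v x = u x"
    "\<And>x. x \<in> frontier \<Omega> \<Longrightarrow> v x = 0"
    using u by (auto simp: W1inf0_nonzero_def W1inf0_def)
  have uL: "u \<in> Linf \<Omega>" and "\<exists>g\<in>Linf \<Omega>. has_weak_gradient \<Omega> u g"
    using u by (auto simp: W1inf0_nonzero_def W1inf0_def W1inf_def)
  then obtain g where g: "g \<in> Linf \<Omega>" "has_weak_gradient \<Omega> u g" by blast
  note wg = weak_gradient_AE_eq[OF \<Omega>(1) g(2,1)]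
  define L where "L = Linf_norm \<Omega> (weak_gradient \<Omega> u)"
  have L: "AE x in ?M. norm (weak_gradient \<Omega> u x) \<le> L"
    unfolding L_def by (rule AE_le_Linf_norm[OF wg(3)])
  have L0: "0 \<le> L"
  proof -
    obtain x where "norm (weak_gradient \<Omega> u x) \<le> L"
      using AE_lebesgue_on_open_imp_ex[OF \<Omega>(1,3) L] by blast
    then show ?thesis using norm_ge_zero order_trans by blast
  qed
  have um: "u \<in> borel_measurable ?M" using uL by (simp add: Linf_def)
  have bound: "\<bar>v x\<bar> \<le> L * d x" if "x \<in> \<Omega>" for x
    unfolding d_def
    using AE_le_Linf_norm[OF uL]
    by (intro le_gradient_bound_times_infdist[OF \<Omega> um _ wg(1) L L0 v that]) simp
  have int_v: "integrable ?M (\<lambda>x. (v x)\<^sup>2)"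
    by (intro integrable_continuous_on_closure \<Omega> continuous_intros v(1))
  have int_d: "integrable ?M (\<lambda>x. (d x)\<^sup>2)"
    by (intro integrable_continuous_on_closure \<Omega> continuous_intros dc)
  have vm: "v \<in> borel_measurable ?M"
    using integrable_continuous_on_closure[OF \<Omega>(1,2) v(1)] by (rule borel_measurable_integrable)
  define I J where "I = (\<integral>x. (v x)\<^sup>2 \<partial>?M)" and "J = (\<integral>x. (d x)\<^sup>2 \<partial>?M)"
  have "(\<integral>x. (u x)\<^sup>2 \<partial>?M) = I"
    unfolding I_def using v(2) um vm
    by (intro integral_cong_AE) (auto elim: eventually_mono)
  then have norm_u: "L2_norm \<Omega> u = sqrt I" and norm_d: "L2_norm \<Omega> d = sqrt J"
    by (simp_all add: L2_norm_def J_def)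
  have pos: "0 < (\<integral>x. (f x)\<^sup>2 \<partial>?M)"
    if "integrable ?M (\<lambda>x. (f x)\<^sup>2)" "\<not> (AE x in ?M. f x = 0)" for f :: "real ^ 'n \<Rightarrow> real"
  proof -
    have "(\<integral>x. (f x)\<^sup>2 \<partial>?M) \<noteq> 0"
      using integral_nonneg_eq_0_iff_AE[OF that(1)] that(2) by simp
    moreover have "0 \<le> (\<integral>x. (f x)\<^sup>2 \<partial>?M)" by simp
    ultimately show ?thesis by linarith
  qed
  have "\<not> (AE x in ?M. v x = 0)"
  proof
    assume "AE x in ?M. v x = 0"
    with v(2) have "AE x in ?M. u x = 0" by eventually_elim simp
    then show False using u by (simp add: W1inf0_nonzero_def)
  qed
  then have I: "0 < I" unfolding I_def by (rule pos[OF int_v])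
  have J: "0 < J" unfolding J_def using d(1) by (intro pos[OF int_d]) (simp add: W1inf0_nonzero_def)
  have "L / sqrt I \<le> 1 / sqrt J"
  proof -
    have "L / sqrt I \<le> Linf_norm \<Omega> (weak_gradient \<Omega> d) / sqrt J"
      using min by (simp add: rayleigh_quotient_def norm_u norm_d L_def)
    also have "\<dots> \<le> 1 / sqrt J" using d(2) J by (intro divide_right_mono) auto
    finally show ?thesis .
  qed
  then have "L * sqrt J \<le> sqrt I" using I J by (simp add: field_simps)
  then have "(L * sqrt J)\<^sup>2 \<le> (sqrt I)\<^sup>2" using L0 J by (intro power_mono) auto
  \<comment> \<open>Minimality against \<open>d\<close>, whose gradient is bounded by 1, is the
    reverse of the integrated pointwise bound.\<close>
  then have LJ: "L\<^sup>2 * J \<le> I" using I J by (simp add: power_mult_distrib)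
  have sq: "(v x)\<^sup>2 \<le> L\<^sup>2 * (d x)\<^sup>2" if "x \<in> \<Omega>" for x
    using power_mono[OF bound[OF that] abs_ge_zero, of 2] by (simp add: power_mult_distrib)
  have int_diff: "integrable ?M (\<lambda>x. L\<^sup>2 * (d x)\<^sup>2 - (v x)\<^sup>2)" using int_v int_d by simp
  have nonneg: "AE x in ?M. 0 \<le> L\<^sup>2 * (d x)\<^sup>2 - (v x)\<^sup>2" using sq by (intro AE_I2) simp
  have "(\<integral>x. L\<^sup>2 * (d x)\<^sup>2 - (v x)\<^sup>2 \<partial>?M) = L\<^sup>2 * J - I"
    using int_v int_d by (simp add: I_def J_def)
  moreover have "0 \<le> (\<integral>x. L\<^sup>2 * (d x)\<^sup>2 - (v x)\<^sup>2 \<partial>?M)" using nonneg by (rule integral_nonneg_AE)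
  ultimately have "(\<integral>x. L\<^sup>2 * (d x)\<^sup>2 - (v x)\<^sup>2 \<partial>?M) = 0" using LJ by linarith
  then have "AE x in ?M. L\<^sup>2 * (d x)\<^sup>2 - (v x)\<^sup>2 = 0"
    using integral_nonneg_eq_0_iff_AE[OF int_diff nonneg] by simp
  then have "AE x in ?M. (v x)\<^sup>2 = (L * d x)\<^sup>2"
    by eventually_elim (simp add: power_mult_distrib)
  moreover have vc: "continuous_on \<Omega> v" using v(1) closure_subset by (rule continuous_on_subset)
  ultimately have eq: "(v x)\<^sup>2 = (L * d x)\<^sup>2" if "x \<in> \<Omega>" for x
    using that \<Omega>(1) dc by (intro continuous_AE_eq_imp_eq[of \<Omega> "\<lambda>x. (v x)\<^sup>2"] continuous_intros) auto
  have d_pos: "0 < d x" if "x \<in> \<Omega>" for x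
  proof -
    have "\<Omega> \<noteq> UNIV" using \<Omega>(2) not_bounded_UNIV by auto
    then show ?thesis unfolding d_def
      using \<Omega> frontier_not_empty[of \<Omega>] that by (intro infdist_frontier_pos) auto
  qed
  have "\<exists>c. \<forall>x\<in>\<Omega>. v x = c * d x"
  proof (cases "L = 0")
    case True
    then show ?thesis using eq by (intro exI[of _ 0]) simp
  next
    case False
    then have nz: "v x \<noteq> 0" if "x \<in> \<Omega>" for x using eq[OF that] d_pos[OF that] by auto
    have conn: "connected (v ` \<Omega>)" using assms(3) vc by (rule connected_continuous_image[rotated])
    \<comment> \<open>A zero-free continuous function on a connected set has constant sign.\<close>
    have "(\<forall>x\<in>\<Omega>. 0 < v x) \<or> (\<forall>x\<in>\<Omega>. v x < 0)"
    proof (rule ccontr)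
      assume "\<not> ?thesis"
      then obtain x y where xy: "x \<in> \<Omega>" "y \<in> \<Omega>" "v x \<le> 0" "0 \<le> v y" by (auto simp: not_less)
      then have "0 \<in> v ` \<Omega>"
        using connectedD_interval[OF conn, of "v x" "v y" 0] by auto
      then show False using nz by auto
    qed
    then show ?thesis
    proof
      assume "\<forall>x\<in>\<Omega>. 0 < v x"
      then have "v x = L * d x" if "x \<in> \<Omega>" for x
        using eq[OF that] that L0 d_pos[OF that] by - (rule power2_eq_imp_eq, auto simp: less_imp_le)
      then show ?thesis by blast
    next
      assume "\<forall>x\<in>\<Omega>. v x < 0"
      then have "- v x = L * d x" if "x \<in> \<Omega>" for x
        using eq[OF that] that L0 d_pos[OF that] by - (rule power2_eq_imp_eq, auto simp: less_imp_le)
      then have "v x = - L * d x" if "x \<in> \<Omega>" for x using that by force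
      then show ?thesis by blast
    qed
  qed
  then obtain c where c: "\<And>x. x \<in> \<Omega> \<Longrightarrow> v x = c * d x" by blast
  have "AE x in ?M. u x = c * infdist x (frontier \<Omega>)"
  proof (rule lebesgue_on_mono[OF v(2)])
    fix x assume "v x = u x" "x \<in> \<Omega>"
    with c[OF this(2)] show "u x = c * infdist x (frontier \<Omega>)" by (simp add: d_def)
  qed
  then show ?thesis by blast
qed

end
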